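(* Assume that for all $k\ge2$, $\ 2\frac{\alpha_1}{\lambda_1^2}<\frac{\alpha_k}{\lambda_k^2}$. Then there exists a time $T_0>0$ such that for any $T>T_0$ there exists a minimizer $y^*\in C([0,T];H)$ satisfying $$I(y^* )=\inf\{I(y): y\in C([0,T];H),\ y(0)=0,\ \exists\, 0\le t\le T \text{ with } |y(t)|_H=L\}.$$ The minimizer $y^*$ has the property that $|y^*(t)|_H<L$ for all $t<T$ and $|y^*(T)|_H=L$. Furthermore, $y^*$ only points in the $e_1$ direction, that is, $\langle y^*(t),e_k\rangle_H=0$ for all $t\in[0,T]$ and all $k\ge2$.
   Context: $H=L^2(\mathcal O)$, with $\mathcal O\subset\mathbb R^d$ a bounded regular domain, inner product $\langle\cdot,\cdot\rangle_H$ and norm $|\cdot|_H$; $(e_k)_{k\ge1}$ is a complete orthonormal basis of $H$. $A$ is an unbounded self-adjoint operator on $H$ with $Ae_k=-\alpha_ke_k$, $0<\alpha_1\le\alpha_2\le\cdots$, generating the semigroup $e^{tA}e_k=e^{-\alpha_kt}e_k$. $B:H\to H$ is bounded with $Be_k=\lambda_ke_k$, $\lambda_k>0$. It is assumed throughout that $\sum_{k\ge1}\lambda_k^2/\alpha_k<\infty$. $L>0$ is fixed. Let $u(x)=\frac{2\alpha_1}{\lambda_1}\langle x,e_1\rangle_He_1$. For $v\in L^2([0,T];H)$ let $X^v$ be the mild solution on $[0,T]$ of $dX^v(t)=[AX^v(t)-Bu(X^v(t))+Bv(t)]\,dt$, $X^v(0)=0$, i.e. $X^v(t)=\int_0^te^{(t-s)A}B\,(v(s)-u(X^v(s)))\,ds$.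 Let $\tau=\inf\{t>0:|X^v(t)|_H\ge L\}$. The functional $I$ is $$I(X^v)=\int_0^\tau\Big(\tfrac12|v(s)|_H^2-|u(X^v(s))|_H^2\Big)ds,$$ (the control $v$ is uniquely determined by the path $X^v$), and $I(y)=+\infty$ if $y$ with $y(0)=0$ is not of the form $X^v$ for any $v\in L^2([0,T];H)$. *)

theory Defs
  imports "HOL-Analysis.Analysis"
begin

text \<open>The state space is an arbitrary separable real Hilbert space, i.e. a type of sort
  \<open>{real_inner, banach, second_countable_topology}\<close>; \<open>L\<^sup>2\<close> of a bounded domain is one,
  and only its Hilbert space structure enters. Sequences are indexed by
  \<open>k \<ge> 1\<close>; their values at 0 are irrelevant.\<close>

definition complete_orthonormal :: "(nat \<Rightarrow> 'h::real_inner) \<Rightarrow> bool" where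
  "complete_orthonormal e \<longleftrightarrow>
     (\<forall>j\<ge>1. \<forall>k\<ge>1. inner (e j) (e k) = (if j = k then 1 else 0)) \<and>
     closure (span (e ` {1..})) = UNIV"

text \<open>An unbounded operator is a domain \<open>D\<close> together with a function \<open>A\<close> of which only the
  values on \<open>D\<close> matter. The last conjunct says that the domain of the adjoint is \<open>D\<close>.\<close>

definition self_adjoint_op :: "'h::real_inner set \<Rightarrow> ('h \<Rightarrow> 'h) \<Rightarrow> bool" where
  "self_adjoint_op D A \<longleftrightarrow>
     subspace D \<and> closure D = UNIV \<and>
     (\<forall>x\<in>D. \<forall>y\<in>D. A (x + y) = A x + A y) \<and>
     (\<forall>c. \<forall>x\<in>D. A (c *\<^sub>R x) = c *\<^sub>R A x) \<and>
     (\<forall>x\<in>D. \<forall>y\<in>D. inner (A x) y = inner x (A y)) \<and>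
     {y. \<exists>z. \<forall>x\<in>D. inner (A x) y = inner x z} = D"

definition C0_semigroup :: "(real \<Rightarrow> 'h::real_normed_vector \<Rightarrow> 'h) \<Rightarrow> bool" where
  "C0_semigroup S \<longleftrightarrow>
     (\<forall>t\<ge>0. bounded_linear (S t)) \<and>
     (\<forall>x. S 0 x = x) \<and>
     (\<forall>s\<ge>0. \<forall>t\<ge>0. \<forall>x. S (s + t) x = S s (S t x)) \<and>
     (\<forall>x. ((\<lambda>t. S t x) \<longlongrightarrow> x) (at_right 0))"

definition generates ::
    "'h::real_normed_vector set \<Rightarrow> ('h \<Rightarrow> 'h) \<Rightarrow> (real \<Rightarrow> 'h \<Rightarrow> 'h) \<Rightarrow> bool" where
  "generates D A S \<longleftrightarrow>
     C0_semigroup S \<and>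
     D = {x. \<exists>z. ((\<lambda>h. (S h x - x) /\<^sub>R h) \<longlongrightarrow> z) (at_right 0)} \<and>
     (\<forall>x\<in>D. ((\<lambda>h. (S h x - x) /\<^sub>R h) \<longlongrightarrow> A x) (at_right 0))"

definition L2_control ::
    "real \<Rightarrow> (real \<Rightarrow> 'h::{real_normed_vector, second_countable_topology}) \<Rightarrow> bool" where
  "L2_control T v \<longleftrightarrow>
     set_borel_measurable lborel {0..T} v \<and>
     set_integrable lborel {0..T} (\<lambda>s. (norm (v s))\<^sup>2)"

definition feedback ::
    "(nat \<Rightarrow> 'h::real_inner) \<Rightarrow> (nat \<Rightarrow> real) \<Rightarrow> (nat \<Rightarrow> real) \<Rightarrow> 'h \<Rightarrow> 'h" where
  "feedback e \<alpha> lam x = (2 * \<alpha> 1 / lam 1 * inner x (e 1)) *\<^sub>R e 1"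

text \<open>\<open>y = X\<^sup>v\<close> on \<open>[0,T]\<close>, where \<open>S t\<close> plays the role of \<open>exp (t A)\<close>. The Bochner integral is 0 for
  non-integrable functions, so integrability is required explicitly.\<close>

definition mild_solution ::
    "(real \<Rightarrow> 'h \<Rightarrow> 'h) \<Rightarrow> ('h \<Rightarrow> 'h) \<Rightarrow> ('h \<Rightarrow> 'h) \<Rightarrow> real \<Rightarrow> (real \<Rightarrow> 'h) \<Rightarrow>
     (real \<Rightarrow> 'h::{real_inner, banach, second_countable_topology}) \<Rightarrow> bool" where
  "mild_solution S B u T v y \<longleftrightarrow>
     continuous_on {0..T} y \<and>
     (\<forall>t\<in>{0..T}.
        set_integrable lborel {0..t} (\<lambda>s. S (t - s) (B (v s - u (y s)))) \<and>
        y t = (LINT s:{0..t}|lborel. S (t - s) (B (v s - u (y s)))))"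

text \<open>For a path that does not reach norm \<open>L\<close> on \<open>[0,T]\<close> the exit time is truncated to \<open>T\<close>; such
  paths are not admissible below.\<close>

definition exit_time :: "real \<Rightarrow> real \<Rightarrow> (real \<Rightarrow> 'h::real_normed_vector) \<Rightarrow> real" where
  "exit_time L T y =
     (if \<exists>t. 0 < t \<and> t \<le> T \<and> L \<le> norm (y t)
      then Inf {t. 0 < t \<and> t \<le> T \<and> L \<le> norm (y t)} else T)"

text \<open>A path determines its control up to a Lebesgue null set. The choice
  operator picks a representative, on which the integral does not depend.\<close>

definition rate_functional ::
    "(real \<Rightarrow> 'h \<Rightarrow> 'h) \<Rightarrow> ('h \<Rightarrow> 'h) \<Rightarrow> ('h \<Rightarrow> 'h) \<Rightarrow> real \<Rightarrow> real \<Rightarrow>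
     (real \<Rightarrow> 'h::{real_inner, banach, second_countable_topology}) \<Rightarrow> ereal" where
  "rate_functional S B u L T y =
     (if \<exists>v. L2_control T v \<and> mild_solution S B u T v y
      then let v = (SOME v. L2_control T v \<and> mild_solution S B u T v y)
           in ereal (LINT s:{0..exit_time L T y}|lborel.
                       1/2 * (norm (v s))\<^sup>2 - (norm (u (y s)))\<^sup>2)
      else \<infinity>)"

definition admissible_paths :: "real \<Rightarrow> real \<Rightarrow> (real \<Rightarrow> 'h::real_normed_vector) set" where
  "admissible_paths L T =
     {y. continuous_on {0..T} y \<and> y 0 = 0 \<and> (\<exists>t\<in>{0..T}. norm (y t) = L)}"

end

theory Submission imports Defs begin

text \<open>Write \<open>y\<^sub>k\<close>, \<open>v\<^sub>k\<close> for the coordinates of a path and its control. The equation decouples: with the forcing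
  \<open>f\<^sub>1 = \<lambda>\<^sub>1 v\<^sub>1 - 2 \<alpha>\<^sub>1 y\<^sub>1\<close> and \<open>f\<^sub>k = \<lambda>\<^sub>k v\<^sub>k\<close> for \<open>k \<ge> 2\<close>, every coordinate solves the scalar mild form of
  \<open>y\<^sub>k' = - \<alpha>\<^sub>k y\<^sub>k + f\<^sub>k\<close> with \<open>y\<^sub>k(0) = 0\<close>, and the action is the sum of the actions of the coordinates.

  In the first coordinate, expressing \<open>v\<^sub>1\<close> by \<open>f\<^sub>1\<close> turns \<open>v\<^sub>1\<^sup>2/2 - (2 \<alpha>\<^sub>1 y\<^sub>1/\<lambda>\<^sub>1)\<^sup>2\<close> into
  \<open>(f\<^sub>1\<^sup>2 + 4 \<alpha>\<^sub>1 y\<^sub>1 (f\<^sub>1 - \<alpha>\<^sub>1 y\<^sub>1)) / (2 \<lambda>\<^sub>1\<^sup>2)\<close>. Since \<open>f\<^sub>1 - \<alpha>\<^sub>1 y\<^sub>1 = y\<^sub>1'\<close>, the second summand is an exact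
  derivative, so the action up to time \<open>t\<close> is \<open>(\<integral> f\<^sub>1\<^sup>2 + 2 \<alpha>\<^sub>1 y\<^sub>1(t)\<^sup>2) / (2 \<lambda>\<^sub>1\<^sup>2)\<close> (lemma \<open>mild_action\<close>). The
  indefinite term has become a boundary term, and only the least energy of a forcing that reaches a given
  value is needed; Cauchy-Schwarz gives it (lemma \<open>mild_forcing_lower_bound\<close>). Hence reaching \<open>r\<close> at time \<open>t\<close>
  costs at least \<open>c(t) r\<^sup>2\<close> with \<open>c(t) = (\<alpha>\<^sub>1/\<lambda>\<^sub>1\<^sup>2) (1 + 1/(1 - exp (- 2 \<alpha>\<^sub>1 t)))\<close> in the first coordinate, and at
  least \<open>(\<alpha>\<^sub>k/\<lambda>\<^sub>k\<^sup>2) r\<^sup>2\<close> in coordinate \<open>k \<ge> 2\<close>.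

  The cost \<open>c\<close> decreases to \<open>2 \<alpha>\<^sub>1/\<lambda>\<^sub>1\<^sup>2\<close>. By assumption this limit is below every \<open>\<alpha>\<^sub>k/\<lambda>\<^sub>k\<^sup>2\<close> with \<open>k \<ge> 2\<close>, and as these
  numbers tend to infinity, it is below them by a uniform gap. So for large \<open>T\<close> the number \<open>c(T)\<close> is at most
  all of the \<open>\<alpha>\<^sub>k/\<lambda>\<^sub>k\<^sup>2\<close>, and it is at most \<open>c(\<tau>)\<close> for every exit time \<open>\<tau> \<le> T\<close>. Summing over the coordinates with
  Bessel's inequality for the control and Parseval's identity for \<open>y(\<tau>)\<close> bounds every action below by
  \<open>c(T) L\<^sup>2\<close> (lemma \<open>rate_functional_lower_bound\<close>).

  The equality case of Cauchy-Schwarz is a forcing proportional to \<open>exp (\<alpha>\<^sub>1 s)\<close>; the corresponding path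
  is \<open>L sinh(\<alpha>\<^sub>1 t)/sinh(\<alpha>\<^sub>1 T) e\<^sub>1\<close>, which stays below norm \<open>L\<close> before time \<open>T\<close> and attains the bound (lemma
  \<open>rate_functional_sinh_path\<close>). The rate functional evaluates the action on some control of the path; two such
  controls agree almost everywhere (lemma \<open>control_unique\<close>), so the explicit one may be used.\<close>

section \<open>Square-integrable controls\<close>

lemma L2_control_continuous:
  fixes f :: "real \<Rightarrow> 'a::{banach, second_countable_topology}"
  assumes "continuous_on {0..T} f"
  shows "L2_control T f"
proof -
  have "set_integrable lborel {0..T} f" "set_integrable lborel {0..T} (\<lambda>s. (norm (f s))\<^sup>2)"
    by (intro borel_integrable_atLeastAtMost' continuous_intros assms)+
  then show ?thesis
    by (auto simp: L2_control_def set_integrable_def set_borel_measurable_def)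
qed

lemma L2_control_subset:
  fixes f :: "real \<Rightarrow> 'a::{real_normed_vector, second_countable_topology}"
  assumes "L2_control T f" "t \<le> T"
  shows "L2_control t f"
proof -
  have "(\<lambda>s. indicator {0..T} s *\<^sub>R f s) \<in> borel_measurable lborel"
    using assms(1) by (simp add: L2_control_def set_borel_measurable_def)
  then have "(\<lambda>s. indicator {0..t} s *\<^sub>R (indicator {0..T} s *\<^sub>R f s)) \<in> borel_measurable lborel"
    by (rule borel_measurable_scaleR[rotated]) auto
  also have "(\<lambda>s. indicator {0..t} s *\<^sub>R (indicator {0..T} s *\<^sub>R f s)) = (\<lambda>s. indicator {0..t} s *\<^sub>R f s)"
    using assms(2) by (auto simp: indicator_def)
  finally show ?thesis
    using assms unfolding L2_control_def set_borel_measurable_def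
    by (auto intro!: set_integrable_subset[of lborel "{0..T}" _ "{0..t}"])
qed

lemma L2_control_mult_integrable:
  fixes f g :: "real \<Rightarrow> real"
  assumes f: "L2_control T f" and g: "L2_control T g"
  shows "set_integrable lborel {0..T} (\<lambda>s. f s * g s)"
proof -
  have m: "(\<lambda>s. indicator {0..T} s *\<^sub>R f s) \<in> borel_measurable lborel"
    "(\<lambda>s. indicator {0..T} s *\<^sub>R g s) \<in> borel_measurable lborel"
    using f g by (auto simp: L2_control_def set_borel_measurable_def)
  have "(\<lambda>s. (indicator {0..T} s *\<^sub>R f s) * (indicator {0..T} s *\<^sub>R g s)) \<in> borel_measurable lborel"
    using m by (rule borel_measurable_times)
  also have "(\<lambda>s. (indicator {0..T} s *\<^sub>R f s) * (indicator {0..T} s *\<^sub>R g s)) =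
     (\<lambda>s. indicator {0..T} s *\<^sub>R (f s * g s))"
    by (auto simp: indicator_def)
  finally have meas: "(\<lambda>s. indicator {0..T} s *\<^sub>R (f s * g s)) \<in> borel_measurable lborel" .
  have "set_integrable lborel {0..T} (\<lambda>s. (norm (f s))\<^sup>2 + (norm (g s))\<^sup>2)"
    using f g by (intro set_integral_add) (auto simp: L2_control_def)
  then show ?thesis
    unfolding set_integrable_def
  proof (rule Bochner_Integration.integrable_bound[OF _ meas], intro AE_I2)
    fix s
    have "2 * \<bar>f s * g s\<bar> \<le> (f s)\<^sup>2 + (g s)\<^sup>2"
      using sum_squares_bound[of "\<bar>f s\<bar>" "\<bar>g s\<bar>"] by (simp add: abs_mult)
    then have "\<bar>f s * g s\<bar> \<le> (f s)\<^sup>2 + (g s)\<^sup>2"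
      using abs_ge_zero[of "f s * g s"] by linarith
    then show "norm (indicator {0..T} s *\<^sub>R (f s * g s))
        \<le> norm (indicator {0..T} s *\<^sub>R ((norm (f s))\<^sup>2 + (norm (g s))\<^sup>2))"
      by (simp add: indicator_def)
  qed
qed

lemma L2_control_integrable:
  fixes f :: "real \<Rightarrow> real"
  assumes "L2_control T f"
  shows "set_integrable lborel {0..T} f"
  using L2_control_mult_integrable[OF assms L2_control_continuous[OF continuous_on_const, of T 1]]
  by simp

lemma L2_control_power2_integrable:
  fixes f :: "real \<Rightarrow> real"
  assumes "L2_control T f"
  shows "set_integrable lborel {0..T} (\<lambda>s. (f s)\<^sup>2)"
  using L2_control_mult_integrable[OF assms assms] by (simp add: power2_eq_square)

lemma L2_control_linear_combination:
  fixes f g :: "real \<Rightarrow> real"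
  assumes f: "L2_control T f" and g: "L2_control T g"
  shows "L2_control T (\<lambda>s. a * f s - b * g s)"
proof -
  have m: "(\<lambda>s. indicator {0..T} s *\<^sub>R f s) \<in> borel_measurable lborel"
    "(\<lambda>s. indicator {0..T} s *\<^sub>R g s) \<in> borel_measurable lborel"
    using f g by (auto simp: L2_control_def set_borel_measurable_def)
  have "(\<lambda>s. a * (indicator {0..T} s *\<^sub>R f s) - b * (indicator {0..T} s *\<^sub>R g s)) \<in> borel_measurable lborel"
    using m by (intro borel_measurable_diff borel_measurable_times) auto
  also have "(\<lambda>s. a * (indicator {0..T} s *\<^sub>R f s) - b * (indicator {0..T} s *\<^sub>R g s)) =
     (\<lambda>s. indicator {0..T} s *\<^sub>R (a * f s - b * g s))"
    by (auto simp: indicator_def)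
  finally have "set_borel_measurable lborel {0..T} (\<lambda>s. a * f s - b * g s)"
    unfolding set_borel_measurable_def .
  moreover have "set_integrable lborel {0..T} (\<lambda>s. a\<^sup>2 * (f s)\<^sup>2 - 2 * a * b * (f s * g s) + b\<^sup>2 * (g s)\<^sup>2)"
    by (intro set_integral_add set_integral_diff set_integrable_mult_right
        L2_control_mult_integrable L2_control_power2_integrable f g)
  then have "set_integrable lborel {0..T} (\<lambda>s. (norm (a * f s - b * g s))\<^sup>2)"
    by (simp add: power2_eq_square algebra_simps)
  ultimately show ?thesis by (simp add: L2_control_def)
qed

lemma L2_control_inner:
  fixes v :: "real \<Rightarrow> 'h::{real_inner, banach, second_countable_topology}"
  assumes "L2_control T v"
  shows "L2_control T (\<lambda>s. inner (v s) x)"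
proof -
  have "(\<lambda>s. indicator {0..T} s *\<^sub>R v s) \<in> borel_measurable lborel"
    using assms by (auto simp: L2_control_def set_borel_measurable_def)
  then have "(\<lambda>s. inner (indicator {0..T} s *\<^sub>R v s) x) \<in> borel_measurable lborel"
    by (intro borel_measurable_inner) auto
  also have "(\<lambda>s. inner (indicator {0..T} s *\<^sub>R v s) x) = (\<lambda>s. indicator {0..T} s *\<^sub>R inner (v s) x)"
    by auto
  finally have m: "(\<lambda>s. indicator {0..T} s *\<^sub>R inner (v s) x) \<in> borel_measurable lborel" .
  have "(\<lambda>s. (indicator {0..T} s *\<^sub>R inner (v s) x)\<^sup>2) \<in> borel_measurable lborel"
    using m by (rule borel_measurable_power)
  also have "(\<lambda>s. (indicator {0..T} s *\<^sub>R inner (v s) x)\<^sup>2) = (\<lambda>s. indicator {0..T} s *\<^sub>R (inner (v s) x)\<^sup>2)"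
    by (auto simp: indicator_def)
  finally have m2: "(\<lambda>s. indicator {0..T} s *\<^sub>R (inner (v s) x)\<^sup>2) \<in> borel_measurable lborel" .
  have "set_integrable lborel {0..T} (\<lambda>s. (norm (v s))\<^sup>2 * (norm x)\<^sup>2)"
    using assms by (auto simp: L2_control_def)
  then have "set_integrable lborel {0..T} (\<lambda>s. (inner (v s) x)\<^sup>2)"
    unfolding set_integrable_def
  proof (rule Bochner_Integration.integrable_bound[OF _ m2], intro AE_I2)
    fix s
    have "\<bar>inner (v s) x\<bar> \<le> norm (v s) * norm x" by (rule Cauchy_Schwarz_ineq2)
    then have "(inner (v s) x)\<^sup>2 \<le> (norm (v s) * norm x)\<^sup>2"
      by (simp add: abs_le_square_iff[symmetric])
    then have "(inner (v s) x)\<^sup>2 \<le> (norm (v s))\<^sup>2 * (norm x)\<^sup>2"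
      by (simp add: power_mult_distrib)
    then show "norm (indicator {0..T} s *\<^sub>R (inner (v s) x)\<^sup>2)
        \<le> norm (indicator {0..T} s *\<^sub>R ((norm (v s))\<^sup>2 * (norm x)\<^sup>2))"
      by (simp add: indicator_def)
  qed
  with m show ?thesis by (simp add: L2_control_def set_borel_measurable_def)
qed

section \<open>Indefinite Lebesgue integrals\<close>

text \<open>Indefinite integrals of merely integrable functions are differentiable only almost everywhere, so the
  product rule is obtained from Fubini's theorem instead of differentiation: the integral of \<open>p(s) q(r)\<close>
  over the square is split along the diagonal, which is a null set.\<close>
lemma indefinite_integral_product_rule:
  fixes p q :: "real \<Rightarrow> real"
  assumes p: "set_integrable lborel {0..t} p" and q: "set_integrable lborel {0..t} q"
  shows "(LINT s:{0..t}|lborel. p s) * (LINT s:{0..t}|lborel. q s) =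
     (LINT s:{0..t}|lborel. p s * (LINT r:{0..s}|lborel. q r)) +
     (LINT s:{0..t}|lborel. q s * (LINT r:{0..s}|lborel. p r))"
proof -
  define p' where "p' s = indicator {0..t} s * p s" for s
  define q' where "q' s = indicator {0..t} s * q s" for s
  have ip: "integrable lborel p'" and iq: "integrable lborel q'"
    using p q by (simp_all add: set_integrable_def p'_def[abs_def] q'_def[abs_def])
  have [measurable]: "p' \<in> borel_measurable borel" "q' \<in> borel_measurable borel"
    using ip iq by auto
  have F: "integrable (lborel \<Otimes>\<^sub>M lborel) (\<lambda>(s, r). p' s * q' r)"
  proof (rule lborel_pair.Fubini_integrable)
    show "integrable lborel (\<lambda>x. LINT y|lborel. norm (case (x, y) of (s, r) \<Rightarrow> p' s * q' r))"
      using ip by (simp add: abs_mult)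
    show "AE x in lborel. integrable lborel (\<lambda>y. case (x, y) of (s, r) \<Rightarrow> p' s * q' r)"
      using iq by simp
  qed measurable
  \<comment> \<open>The closed half-plane below the diagonal; its complement carries the other order of integration.\<close>
  define lower where "lower = {z::real \<times> real. snd z \<le> fst z}"
  have [measurable]: "lower \<in> sets (lborel \<Otimes>\<^sub>M lborel)"
  proof -
    have "closed lower" unfolding lower_def by (intro closed_Collect_le continuous_intros)
    then have "lower \<in> sets borel" by (rule borel_closed)
    moreover have "sets (lborel \<Otimes>\<^sub>M lborel) = sets (borel :: (real \<times> real) measure)"
      by (metis lborel_prod sets_lborel)
    ultimately show ?thesis by simp
  qed
  have F1: "integrable (lborel \<Otimes>\<^sub>M lborel) (\<lambda>(s, r). indicator lower (s, r) * (p' s * q' r))"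
    using integrable_mult_indicator[OF \<open>lower \<in> _\<close> F] by (simp add: case_prod_unfold)
  have F2: "integrable (lborel \<Otimes>\<^sub>M lborel) (\<lambda>(s, r). indicator (- lower) (s, r) * (p' s * q' r))"
  proof -
    have "- lower \<in> sets (lborel \<Otimes>\<^sub>M lborel)"
      using \<open>lower \<in> _\<close> sets.compl_sets[of lower "lborel \<Otimes>\<^sub>M lborel"]
      by (simp add: space_pair_measure Compl_eq_Diff_UNIV)
    then show ?thesis
      using integrable_mult_indicator[OF _ F] by (simp add: case_prod_unfold)
  qed
  have part1: "(\<integral>z. (case z of (s, r) \<Rightarrow> indicator lower (s, r) * (p' s * q' r)) \<partial>(lborel \<Otimes>\<^sub>M lborel)) =
      (LINT s:{0..t}|lborel. p s * (LINT r:{0..s}|lborel. q r))"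
  proof -
    have "(\<integral>z. (case z of (s, r) \<Rightarrow> indicator lower (s, r) * (p' s * q' r)) \<partial>(lborel \<Otimes>\<^sub>M lborel)) =
      (\<integral>s. (\<integral>r. indicator lower (s, r) * (p' s * q' r) \<partial>lborel) \<partial>lborel)"
      by (rule lborel_pair.integral_fst[OF F1, symmetric])
    also have "\<dots> = (\<integral>s. p' s * (\<integral>r. indicator lower (s, r) * q' r \<partial>lborel) \<partial>lborel)"
      by (subst integral_mult_right_zero[symmetric]) (simp add: mult_ac)
    also have "\<dots> = (\<integral>s. indicator {0..t} s * (p s * (LINT r:{0..s}|lborel. q r)) \<partial>lborel)"
    proof (intro Bochner_Integration.integral_cong refl)
      fix s
      have "(\<integral>r. indicator lower (s, r) * q' r \<partial>lborel) = (LINT r:{0..s}|lborel. q r)" if "s \<in> {0..t}"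
        unfolding set_lebesgue_integral_def using that
        by (intro Bochner_Integration.integral_cong refl)
          (auto simp: q'_def lower_def indicator_def)
      then show "p' s * (\<integral>r. indicator lower (s, r) * q' r \<partial>lborel) =
          indicator {0..t} s * (p s * (LINT r:{0..s}|lborel. q r))"
        by (simp add: p'_def indicator_def)
    qed
    finally show ?thesis by (simp add: set_lebesgue_integral_def)
  qed
  have part2: "(\<integral>z. (case z of (s, r) \<Rightarrow> indicator (- lower) (s, r) * (p' s * q' r)) \<partial>(lborel \<Otimes>\<^sub>M lborel)) =
      (LINT r:{0..t}|lborel. q r * (LINT s:{0..r}|lborel. p s))"
  proof -
    have "(\<integral>z. (case z of (s, r) \<Rightarrow> indicator (- lower) (s, r) * (p' s * q' r)) \<partial>(lborel \<Otimes>\<^sub>M lborel)) =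
      (\<integral>r. (\<integral>s. indicator (- lower) (s, r) * (p' s * q' r) \<partial>lborel) \<partial>lborel)"
      by (rule lborel_pair.integral_snd[OF F2, symmetric])
    also have "\<dots> = (\<integral>r. q' r * (\<integral>s. indicator (- lower) (s, r) * p' s \<partial>lborel) \<partial>lborel)"
      by (subst integral_mult_right_zero[symmetric]) (simp add: mult_ac)
    also have "\<dots> = (\<integral>r. indicator {0..t} r * (q r * (LINT s:{0..r}|lborel. p s)) \<partial>lborel)"
    proof (intro Bochner_Integration.integral_cong refl)
      fix r
      have "(\<integral>s. indicator (- lower) (s, r) * p' s \<partial>lborel) = (LINT s:{0..r}|lborel. p s)" if "r \<in> {0..t}"
        unfolding set_lebesgue_integral_def using that
        by (intro integral_discrete_difference[where X = "{r}"])
          (auto simp: p'_def lower_def indicator_def)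
      then show "q' r * (\<integral>s. indicator (- lower) (s, r) * p' s \<partial>lborel) =
          indicator {0..t} r * (q r * (LINT s:{0..r}|lborel. p s))"
        by (simp add: q'_def indicator_def)
    qed
    finally show ?thesis by (simp add: set_lebesgue_integral_def)
  qed
  have "(LINT s:{0..t}|lborel. p s) * (LINT s:{0..t}|lborel. q s) = (\<integral>s. (\<integral>r. p' s * q' r \<partial>lborel) \<partial>lborel)"
    by (simp add: set_lebesgue_integral_def p'_def q'_def)
  also have "\<dots> = (\<integral>z. (case z of (s, r) \<Rightarrow> p' s * q' r) \<partial>(lborel \<Otimes>\<^sub>M lborel))"
    by (rule lborel_pair.integral_fst[OF F])
  also have "\<dots> = (\<integral>z. (case z of (s, r) \<Rightarrow> indicator lower (s, r) * (p' s * q' r)) +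
      (case z of (s, r) \<Rightarrow> indicator (- lower) (s, r) * (p' s * q' r)) \<partial>(lborel \<Otimes>\<^sub>M lborel))"
    by (intro Bochner_Integration.integral_cong refl) (auto simp: indicator_def)
  also have "\<dots> = (\<integral>z. (case z of (s, r) \<Rightarrow> indicator lower (s, r) * (p' s * q' r)) \<partial>(lborel \<Otimes>\<^sub>M lborel)) +
      (\<integral>z. (case z of (s, r) \<Rightarrow> indicator (- lower) (s, r) * (p' s * q' r)) \<partial>(lborel \<Otimes>\<^sub>M lborel))"
    by (rule Bochner_Integration.integral_add[OF F1 F2])
  finally show ?thesis by (simp only: part1 part2)
qed

text \<open>The positive and the negative part of \<open>g\<close> are densities of two measures that agree on all half-lines,
  hence coincide, and densities are unique.\<close>
lemma zero_indefinite_integral_imp_AE_zero: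
  fixes g :: "real \<Rightarrow> real"
  assumes g: "set_integrable lborel {0..T} g"
    and zero: "\<And>t. t \<in> {0..T} \<Longrightarrow> (LINT s:{0..t}|lborel. g s) = 0"
  shows "AE s in lborel. s \<in> {0..T} \<longrightarrow> g s = 0"
proof (cases "0 \<le> T")
  case True
  define h where "h s = indicator {0..T} s * g s" for s
  have h: "integrable lborel h"
    using g by (simp add: set_integrable_def h_def[abs_def])
  have [measurable]: "h \<in> borel_measurable borel" using h by auto
  have tail: "(LINT s:{x<..}|lborel. h s) = 0" for x
  proof -
    have hx: "set_integrable lborel A h" if "A \<in> sets lborel" for A
      unfolding set_integrable_def using that by (rule integrable_mult_indicator[OF _ h])
    have head: "(LINT s:{..x}|lborel. h s) = 0" for x
    proof -
      consider "x < 0" | "x \<in> {0..T}" | "T < x" by force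
      then show ?thesis
      proof cases
        case 1
        have "(LINT s:{..x}|lborel. h s) = (\<integral>s. 0 \<partial>(lborel :: real measure))"
          unfolding set_lebesgue_integral_def
          by (intro Bochner_Integration.integral_cong refl) (use 1 in \<open>auto simp: h_def indicator_def\<close>)
        then show ?thesis by simp
      next
        case 2
        have "(LINT s:{..x}|lborel. h s) = (LINT s:{0..x}|lborel. g s)"
          unfolding set_lebesgue_integral_def
          by (intro Bochner_Integration.integral_cong refl) (use 2 in \<open>auto simp: h_def indicator_def\<close>)
        then show ?thesis using zero[OF 2] by simp
      next
        case 3
        have "(LINT s:{..x}|lborel. h s) = (LINT s:{0..T}|lborel. g s)"
          unfolding set_lebesgue_integral_def
          by (intro Bochner_Integration.integral_cong refl) (use 3 in \<open>auto simp: h_def indicator_def\<close>)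
        then show ?thesis using zero[of T] True by simp
      qed
    qed
    have "(LINT s:{..max x T}|lborel. h s) = (LINT s:{..x} \<union> {x<..max x T}|lborel. h s)"
      by (simp add: ivl_disj_un)
    also have "\<dots> = (LINT s:{..x}|lborel. h s) + (LINT s:{x<..max x T}|lborel. h s)"
      by (intro set_integral_Un hx) auto
    finally have "(LINT s:{x<..max x T}|lborel. h s) = 0" by (simp add: head)
    moreover have "(LINT s:{x<..max x T}|lborel. h s) = (LINT s:{x<..}|lborel. h s)"
      unfolding set_lebesgue_integral_def
      by (intro Bochner_Integration.integral_cong refl) (auto simp: h_def indicator_def)
    ultimately show ?thesis by simp
  qed
  have pos: "integrable lborel (\<lambda>s. max 0 (h s))" and neg: "integrable lborel (\<lambda>s. max 0 (- h s))"
    using h by auto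
  have ipos: "integrable lborel (\<lambda>s. indicator A s * max 0 (h s))"
    and ineg: "integrable lborel (\<lambda>s. indicator A s * max 0 (- h s))" if "A \<in> sets lborel" for A
    using integrable_mult_indicator[OF that pos] integrable_mult_indicator[OF that neg] by auto
  have em: "emeasure (density lborel (\<lambda>s. ennreal (max 0 (h s)))) A = ennreal (\<integral>s. indicator A s * max 0 (h s) \<partial>lborel)"
    "emeasure (density lborel (\<lambda>s. ennreal (max 0 (- h s)))) A = ennreal (\<integral>s. indicator A s * max 0 (- h s) \<partial>lborel)"
    if A: "A \<in> sets lborel" for A
    using A ipos[OF A] ineg[OF A]
    by (subst emeasure_density, simp, simp, subst nn_integral_eq_integral[symmetric], simp, simp,
        auto intro!: nn_integral_cong simp: indicator_def)+
  have "density lborel (\<lambda>s. ennreal (max 0 (h s))) = density lborel (\<lambda>s. ennreal (max 0 (- h s)))"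
  proof (rule measure_eqI_lessThan)
    fix x
    show "emeasure (density lborel (\<lambda>s. ennreal (max 0 (h s)))) {x<..} < \<infinity>"
      by (simp add: em)
    have "0 = (LINT s:{x<..}|lborel. h s)" by (simp add: tail)
    also have "\<dots> = (\<integral>s. indicator {x<..} s * max 0 (h s) - indicator {x<..} s * max 0 (- h s) \<partial>lborel)"
      unfolding set_lebesgue_integral_def
      by (intro Bochner_Integration.integral_cong refl) (auto simp: indicator_def max_def)
    also have "\<dots> = (\<integral>s. indicator {x<..} s * max 0 (h s) \<partial>lborel) - (\<integral>s. indicator {x<..} s * max 0 (- h s) \<partial>lborel)"
      by (intro Bochner_Integration.integral_diff ipos ineg) auto
    finally show "emeasure (density lborel (\<lambda>s. ennreal (max 0 (h s)))) {x<..} =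
        emeasure (density lborel (\<lambda>s. ennreal (max 0 (- h s)))) {x<..}"
      by (simp add: em)
  qed auto
  then have "AE s in lborel. ennreal (max 0 (h s)) = ennreal (max 0 (- h s))"
    by (intro sigma_finite_measure.density_unique[OF sigma_finite_lborel]) auto
  then show ?thesis
  proof eventually_elim
    case (elim s)
    then have "max 0 (h s) = max 0 (- h s)" by (simp add: ennreal_inj)
    then show ?case by (auto simp: h_def max_def split: if_splits)
  qed
qed auto

section \<open>The scalar mild equation\<close>

lemma set_integrable_continuous_mult:
  fixes f g :: "real \<Rightarrow> real"
  assumes f: "set_integrable lborel {0..T} f" and g: "continuous_on {0..T} g"
  shows "set_integrable lborel {0..T} (\<lambda>s. g s * f s)"
proof -
  obtain K where K: "\<bar>g s\<bar> \<le> K" if "s \<in> {0..T}" for s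
    using compact_imp_bounded[OF compact_continuous_image[OF g compact_Icc]]
    unfolding bounded_iff by (metis imageI real_norm_def)
  have "(\<lambda>s. (indicator {0..T} s *\<^sub>R g s) * (indicator {0..T} s *\<^sub>R f s)) \<in> borel_measurable lborel"
    using f borel_integrable_atLeastAtMost'[OF g] by (auto simp: set_integrable_def)
  also have "(\<lambda>s. (indicator {0..T} s *\<^sub>R g s) * (indicator {0..T} s *\<^sub>R f s)) =
     (\<lambda>s. indicator {0..T} s *\<^sub>R (g s * f s))"
    by (auto simp: indicator_def)
  finally have meas: "(\<lambda>s. indicator {0..T} s *\<^sub>R (g s * f s)) \<in> borel_measurable lborel" .
  have "set_integrable lborel {0..T} (\<lambda>s. K * f s)" using f by simp
  then show ?thesis
    unfolding set_integrable_def
  proof (rule Bochner_Integration.integrable_bound[OF _ meas], intro AE_I2)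
    fix s
    show "norm (indicator {0..T} s *\<^sub>R (g s * f s)) \<le> norm (indicator {0..T} s *\<^sub>R (K * f s))"
    proof (cases "s \<in> {0..T}")
      case True
      then have "\<bar>g s\<bar> \<le> \<bar>K\<bar>" using K[OF True] by linarith
      then show ?thesis by (simp add: abs_mult indicator_def mult_right_mono)
    qed simp
  qed
qed

lemma exp_time_shift: "exp (- a * (t - s)) = exp (- a * t) * exp (a * s)" for a t s :: real
  by (simp flip: exp_add add: algebra_simps)

lemma integral_exp_linear:
  fixes b :: real
  assumes "b \<noteq> 0" "0 \<le> t"
  shows "(LINT s:{0..t}|lborel. exp (b * s)) = (exp (b * t) - 1) / b"
proof -
  have "(\<integral>s. exp (b * s) * indicator {0..t} s \<partial>lborel) = exp (b * t) / b - exp (b * 0) / b"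
    by (rule integral_FTC_Icc_real[where F = "\<lambda>s. exp (b * s) / b"])
      (use assms in \<open>auto intro!: derivative_eq_intros continuous_intros\<close>)
  then show ?thesis
    by (simp add: set_lebesgue_integral_def mult.commute diff_divide_distrib)
qed

text \<open>The integrated form of \<open>y' = f - a y\<close>. It is the product rule applied to the two factors of
  \<open>y(t) = exp (- a t) G(t)\<close>, where \<open>G\<close> is the indefinite integral of \<open>exp (a s) f(s)\<close>.\<close>
lemma mild_imp_integral_equation:
  fixes f y :: "real \<Rightarrow> real"
  assumes a: "a \<noteq> 0"
    and f: "set_integrable lborel {0..T} f"
    and y: "continuous_on {0..T} y"
    and mild: "\<And>t. t \<in> {0..T} \<Longrightarrow> y t = (LINT s:{0..t}|lborel. exp (- a * (t - s)) * f s)"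
    and t: "t \<in> {0..T}"
  shows "y t = (LINT s:{0..t}|lborel. f s - a * y s)"
proof -
  define p where "p s = exp (a * s) * f s" for s
  define q where "q s = - a * exp (- a * s)" for s
  define G where "G s = (LINT r:{0..s}|lborel. p r)" for s
  have ft: "set_integrable lborel {0..t} f" and yt: "continuous_on {0..t} y"
    using f y t by (auto intro: set_integrable_subset[of _ "{0..T}"] continuous_on_subset)
  have p: "set_integrable lborel {0..t} p"
    unfolding p_def by (intro set_integrable_continuous_mult ft continuous_intros)
  have q: "set_integrable lborel {0..t} q"
    unfolding q_def by (intro borel_integrable_atLeastAtMost' continuous_intros)
  have yi: "set_integrable lborel {0..t} y"
    using yt by (rule borel_integrable_atLeastAtMost')
  have yG: "y s = exp (- a * s) * G s" if "s \<in> {0..T}" for s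
  proof -
    have "exp (- a * (s - r)) * f r = exp (- a * s) * p r" for r
      by (simp only: p_def exp_time_shift mult.assoc)
    then show ?thesis using mild[OF that] by (simp add: G_def)
  qed
  have Q: "(LINT r:{0..s}|lborel. q r) = exp (- a * s) - 1" if "s \<in> {0..t}" for s
  proof -
    have "(LINT r:{0..s}|lborel. q r) = - a * (LINT r:{0..s}|lborel. exp (- a * r))"
      unfolding q_def by (rule set_integral_mult_right)
    also have "\<dots> = - a * ((exp (- a * s) - 1) / - a)"
      by (subst integral_exp_linear) (use that a in auto)
    finally show ?thesis using a by simp
  qed
  have "G t * (exp (- a * t) - 1) = (LINT s:{0..t}|lborel. p s * (LINT r:{0..s}|lborel. q r)) +
      (LINT s:{0..t}|lborel. q s * G s)"
    using indefinite_integral_product_rule[OF p q] Q[of t] t by (simp add: G_def)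
  also have "(LINT s:{0..t}|lborel. p s * (LINT r:{0..s}|lborel. q r)) = (LINT s:{0..t}|lborel. f s - p s)"
  proof (intro set_lebesgue_integral_cong allI impI)
    fix s assume s: "s \<in> {0..t}"
    show "p s * (LINT r:{0..s}|lborel. q r) = f s - p s"
      unfolding Q[OF s] by (simp add: p_def algebra_simps exp_minus)
  qed simp
  also have "\<dots> = (LINT s:{0..t}|lborel. f s) - G t"
    unfolding G_def by (intro set_integral_diff ft p)
  also have "(LINT s:{0..t}|lborel. q s * G s) = (LINT s:{0..t}|lborel. - a * y s)"
    using t by (intro set_lebesgue_integral_cong) (auto simp: q_def yG)
  also have "(LINT s:{0..t}|lborel. - a * y s) = - (LINT s:{0..t}|lborel. a * y s)"
    unfolding set_integral_mult_right by simp
  finally have "y t = (LINT s:{0..t}|lborel. f s) - (LINT s:{0..t}|lborel. a * y s)"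
    using yG[OF t] by (simp add: algebra_simps)
  also have "\<dots> = (LINT s:{0..t}|lborel. f s - a * y s)"
    using ft yi by (subst set_integral_diff) auto
  finally show ?thesis .
qed

text \<open>This is \<open>(y\<^sup>2)' = 2 y' y\<close> in integrated form: the product rule with both factors equal to \<open>y\<close>.\<close>
lemma mild_energy_identity:
  fixes f y :: "real \<Rightarrow> real"
  assumes a: "a \<noteq> 0" and T: "0 \<le> T"
    and f: "set_integrable lborel {0..T} f"
    and y: "continuous_on {0..T} y"
    and mild: "\<And>t. t \<in> {0..T} \<Longrightarrow> y t = (LINT s:{0..t}|lborel. exp (- a * (t - s)) * f s)"
  shows "(y T)\<^sup>2 = 2 * (LINT s:{0..T}|lborel. (f s - a * y s) * y s)"
proof -
  define p where "p s = f s - a * y s" for s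
  have p: "set_integrable lborel {0..T} p"
    unfolding p_def using f borel_integrable_atLeastAtMost'[OF y] by (intro set_integral_diff) auto
  have P: "(LINT r:{0..s}|lborel. p r) = y s" if "s \<in> {0..T}" for s
    unfolding p_def using mild_imp_integral_equation[OF a f y mild that] by simp
  have "y T * y T = 2 * (LINT s:{0..T}|lborel. p s * (LINT r:{0..s}|lborel. p r))"
    using indefinite_integral_product_rule[OF p p] P[of T] T by simp
  also have "(LINT s:{0..T}|lborel. p s * (LINT r:{0..s}|lborel. p r)) = (LINT s:{0..T}|lborel. p s * y s)"
    by (intro set_lebesgue_integral_cong) (auto simp: P)
  finally show ?thesis by (simp add: p_def power2_eq_square)
qed

text \<open>The integrand equals \<open>f\<^sup>2 + 4 a (f - a y) y\<close>, whose second summand integrates to \<open>2 a y(T)\<^sup>2\<close>. The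
  weights \<open>2 a\<close> and \<open>8 a\<^sup>2\<close> are those of the running cost of the first coordinate, up to a constant factor.\<close>
lemma mild_action:
  fixes f y :: "real \<Rightarrow> real"
  assumes a: "a \<noteq> 0" and T: "0 \<le> T"
    and f: "L2_control T f"
    and y: "continuous_on {0..T} y"
    and mild: "\<And>t. t \<in> {0..T} \<Longrightarrow> y t = (LINT s:{0..t}|lborel. exp (- a * (t - s)) * f s)"
  shows "(LINT s:{0..T}|lborel. (f s + 2 * a * y s)\<^sup>2 - 8 * a\<^sup>2 * (y s)\<^sup>2) =
    (LINT s:{0..T}|lborel. (f s)\<^sup>2) + 2 * a * (y T)\<^sup>2"
proof -
  have Ly: "L2_control T y" using y by (rule L2_control_continuous)
  have i2: "set_integrable lborel {0..T} (\<lambda>s. (f s - a * y s) * y s)"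
    using L2_control_mult_integrable[OF L2_control_linear_combination[OF f Ly, of 1 a] Ly] by simp
  have "(LINT s:{0..T}|lborel. (f s + 2 * a * y s)\<^sup>2 - 8 * a\<^sup>2 * (y s)\<^sup>2) =
    (LINT s:{0..T}|lborel. (f s)\<^sup>2 + 4 * a * ((f s - a * y s) * y s))"
    by (intro set_lebesgue_integral_cong) (auto simp: power2_eq_square algebra_simps)
  also have "\<dots> = (LINT s:{0..T}|lborel. (f s)\<^sup>2) + (LINT s:{0..T}|lborel. 4 * a * ((f s - a * y s) * y s))"
    by (intro set_integral_add L2_control_power2_integrable f set_integrable_mult_right i2)
  also have "(LINT s:{0..T}|lborel. 4 * a * ((f s - a * y s) * y s)) = 2 * a * (y T)\<^sup>2"
    using mild_energy_identity[OF a T L2_control_integrable[OF f] y mild] by simp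
  finally show ?thesis .
qed

text \<open>Cauchy-Schwarz: the integral is the inner product of \<open>f\<close> with the kernel \<open>h(s) = exp (- a (T - s))\<close>,
  whose squared norm is \<open>K = (1 - exp (- 2 a T))/(2 a)\<close>.\<close>
lemma mild_forcing_lower_bound:
  fixes f :: "real \<Rightarrow> real"
  assumes a: "0 < a" and T: "0 < T" and f: "L2_control T f"
  shows "2 * a / (1 - exp (- 2 * a * T)) * (LINT s:{0..T}|lborel. exp (- a * (T - s)) * f s)\<^sup>2
     \<le> (LINT s:{0..T}|lborel. (f s)\<^sup>2)"
proof -
  define h where "h s = exp (- a * (T - s))" for s
  define r where "r = (LINT s:{0..T}|lborel. h s * f s)"
  define K where "K = (1 - exp (- 2 * a * T)) / (2 * a)"
  define c where "c = r / K"
  have K: "0 < K" using a T by (simp add: K_def)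
  have hsq: "(LINT s:{0..T}|lborel. (h s)\<^sup>2) = K"
  proof -
    have "exp (- 2 * a * T) = (exp (- a * T))\<^sup>2" "exp ((2 * a) * s) = (exp (a * s))\<^sup>2" for s
      using exp_double[of "- a * T"] exp_double[of "a * s"] by (simp_all add: mult.assoc)
    then have "(h s)\<^sup>2 = exp (- 2 * a * T) * exp ((2 * a) * s)" for s
      by (simp only: h_def exp_time_shift power_mult_distrib)
    then have "(LINT s:{0..T}|lborel. (h s)\<^sup>2) = exp (- 2 * a * T) * ((exp (2 * a * T) - 1) / (2 * a))"
      using a T by (simp add: integral_exp_linear del: exp_diff)
    also have "\<dots> = K"
      by (simp add: K_def algebra_simps exp_minus)
    finally show ?thesis .
  qed
  have Lh: "L2_control T h" unfolding h_def by (intro L2_control_continuous continuous_intros)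
  \<comment> \<open>Here \<open>c h\<close> is the orthogonal projection of \<open>f\<close> onto the line spanned by \<open>h\<close>.\<close>
  have "0 \<le> (LINT s:{0..T}|lborel. (f s - c * h s)\<^sup>2)"
    unfolding set_lebesgue_integral_def by (intro Bochner_Integration.integral_nonneg) simp
  also have "\<dots> = (LINT s:{0..T}|lborel. (f s)\<^sup>2 - 2 * c * (h s * f s) + c\<^sup>2 * (h s)\<^sup>2)"
    by (intro set_lebesgue_integral_cong) (auto simp: power2_eq_square algebra_simps)
  also have "\<dots> = (LINT s:{0..T}|lborel. (f s)\<^sup>2 - 2 * c * (h s * f s)) + (LINT s:{0..T}|lborel. c\<^sup>2 * (h s)\<^sup>2)"
    by (intro set_integral_add set_integral_diff set_integrable_mult_right
        L2_control_power2_integrable L2_control_mult_integrable f Lh)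
  also have "(LINT s:{0..T}|lborel. (f s)\<^sup>2 - 2 * c * (h s * f s)) =
      (LINT s:{0..T}|lborel. (f s)\<^sup>2) - (LINT s:{0..T}|lborel. 2 * c * (h s * f s))"
    by (intro set_integral_diff set_integrable_mult_right
        L2_control_power2_integrable L2_control_mult_integrable f Lh)
  finally have "2 * c * r - c\<^sup>2 * K \<le> (LINT s:{0..T}|lborel. (f s)\<^sup>2)"
    by (simp add: hsq r_def)
  moreover have "2 * c * r - c\<^sup>2 * K = r\<^sup>2 / K"
    using K by (simp add: c_def power2_eq_square field_simps)
  ultimately have "2 * a / (1 - exp (- 2 * a * T)) * r\<^sup>2 \<le> (LINT s:{0..T}|lborel. (f s)\<^sup>2)"
    by (simp add: K_def mult.commute)
  then show ?thesis by (simp only: r_def h_def)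
qed

text \<open>Multiplying by \<open>exp (a t)\<close> removes the dependence of the kernel on \<open>t\<close>, so the indefinite integrals of
  \<open>exp (a s) (f - g)(s)\<close> vanish.\<close>
lemma mild_forcing_unique:
  fixes f g :: "real \<Rightarrow> real"
  assumes f: "set_integrable lborel {0..T} f" and g: "set_integrable lborel {0..T} g"
    and eq: "\<And>t. t \<in> {0..T} \<Longrightarrow> (LINT s:{0..t}|lborel. exp (- a * (t - s)) * f s) =
               (LINT s:{0..t}|lborel. exp (- a * (t - s)) * g s)"
  shows "AE s in lborel. s \<in> {0..T} \<longrightarrow> f s = g s"
proof -
  have i: "set_integrable lborel {0..t} (\<lambda>s. exp (a * s) * k s)"
    if "set_integrable lborel {0..T} k" "t \<le> T" for t and k :: "real \<Rightarrow> real"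
    by (intro set_integrable_continuous_mult set_integrable_subset[OF that(1)] continuous_intros)
      (use that in auto)
  have shift: "(LINT s:{0..t}|lborel. exp (- a * (t - s)) * k s) =
      exp (- a * t) * (LINT s:{0..t}|lborel. exp (a * s) * k s)" for k t
  proof -
    have "exp (- a * (t - s)) * k s = exp (- a * t) * (exp (a * s) * k s)" for s
      by (simp only: exp_time_shift mult.assoc)
    then show ?thesis by (simp only: set_integral_mult_right)
  qed
  have "AE s in lborel. s \<in> {0..T} \<longrightarrow> exp (a * s) * f s - exp (a * s) * g s = 0"
  proof (rule zero_indefinite_integral_imp_AE_zero)
    show "set_integrable lborel {0..T} (\<lambda>s. exp (a * s) * f s - exp (a * s) * g s)"
      by (intro set_integral_diff i f g) auto
    fix t assume t: "t \<in> {0..T}"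
    then have "(LINT s:{0..t}|lborel. exp (a * s) * f s - exp (a * s) * g s) =
        (LINT s:{0..t}|lborel. exp (a * s) * f s) - (LINT s:{0..t}|lborel. exp (a * s) * g s)"
      by (intro set_integral_diff i f g) auto
    then show "(LINT s:{0..t}|lborel. exp (a * s) * f s - exp (a * s) * g s) = 0"
      using eq[OF t] unfolding shift by simp
  qed
  then show ?thesis by eventually_elim auto
qed

section \<open>Fourier coefficients\<close>

lemma complete_orthonormal_inner:
  assumes "complete_orthonormal e" "1 \<le> j" "1 \<le> k"
  shows "inner (e j) (e k) = (if j = k then 1 else 0)"
  using assms by (auto simp: complete_orthonormal_def)

lemma complete_orthonormal_norm:
  assumes "complete_orthonormal e" "1 \<le> k"
  shows "norm (e k) = 1"
  using complete_orthonormal_inner[OF assms(1,2,2)] by (simp add: norm_eq_sqrt_inner)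

text \<open>With \<open>c k = inner x (e k)\<close> this yields Bessel's inequality; for other \<open>c\<close> it says that the Fourier
  coefficients give the best approximation, which with density of the span yields Parseval's identity.\<close>
lemma orthonormal_approximation_error:
  fixes e :: "nat \<Rightarrow> 'h::real_inner"
  assumes e: "complete_orthonormal e"
  shows "(norm (x - (\<Sum>k=1..N. c k *\<^sub>R e k)))\<^sup>2 =
    (norm x)\<^sup>2 - (\<Sum>k=1..N. (inner x (e k))\<^sup>2) + (\<Sum>k=1..N. (c k - inner x (e k))\<^sup>2)"
proof -
  let ?P = "\<Sum>k=1..N. c k *\<^sub>R e k"
  have xP: "inner x ?P = (\<Sum>k=1..N. c k * inner x (e k))"
    by (simp add: inner_sum_right)
  have "inner ?P ?P = (\<Sum>k=1..N. c k * inner (e k) ?P)"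
    by (simp add: inner_sum_left)
  also have "\<dots> = (\<Sum>k=1..N. (c k)\<^sup>2)"
  proof (intro sum.cong refl)
    fix k assume k: "k \<in> {1..N}"
    have "inner (e k) ?P = (\<Sum>j=1..N. c j * inner (e k) (e j))"
      by (simp add: inner_sum_right)
    also have "\<dots> = (\<Sum>j=1..N. if j = k then c j else 0)"
      using k by (intro sum.cong refl) (auto simp: complete_orthonormal_inner[OF e])
    also have "\<dots> = c k" using k by simp
    finally show "c k * inner (e k) ?P = (c k)\<^sup>2" by (simp add: power2_eq_square)
  qed
  finally have PP: "inner ?P ?P = (\<Sum>k=1..N. (c k)\<^sup>2)" .
  have "(norm (x - ?P))\<^sup>2 = (norm x)\<^sup>2 - 2 * inner x ?P + inner ?P ?P"
    by (simp only: power2_norm_eq_inner) (simp add: inner_diff inner_commute)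
  also have "\<dots> = (norm x)\<^sup>2 - (\<Sum>k=1..N. (inner x (e k))\<^sup>2) + (\<Sum>k=1..N. (c k - inner x (e k))\<^sup>2)"
    unfolding xP PP
    by (simp add: power2_diff sum.distrib sum_subtractf sum_distrib_left algebra_simps)
  finally show ?thesis .
qed

lemma bessel_inequality:
  fixes e :: "nat \<Rightarrow> 'h::real_inner"
  assumes "complete_orthonormal e"
  shows "(\<Sum>k=1..N. (inner x (e k))\<^sup>2) \<le> (norm x)\<^sup>2"
  using orthonormal_approximation_error[OF assms, of x "\<lambda>k. inner x (e k)" N]
    zero_le_power2[of "norm (x - (\<Sum>k=1..N. inner x (e k) *\<^sub>R e k))"]
  by simp

lemma span_sequence_imp_finite_sum:
  fixes e :: "nat \<Rightarrow> 'h::real_vector"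
  assumes "z \<in> span (e ` {1..})"
  shows "\<exists>N c. z = (\<Sum>k=1..N. c k *\<^sub>R e k)"
  using assms
proof (induction rule: span_induct_alt)
  case base
  show ?case by (rule exI[of _ 0]) simp
next
  case (step a x z)
  then obtain j N c where j: "1 \<le> j" "x = e j" and z: "z = (\<Sum>k=1..N. c k *\<^sub>R e k)" by auto
  define M where "M = max N j"
  define d where "d k = (if k = j then a else 0) + (if k \<le> N then c k else 0)" for k
  have "(\<Sum>k=1..M. d k *\<^sub>R e k) =
      (\<Sum>k=1..M. if k = j then a *\<^sub>R e k else 0) + (\<Sum>k=1..M. if k \<le> N then c k *\<^sub>R e k else 0)"
    unfolding sum.distrib[symmetric] by (intro sum.cong) (auto simp: d_def scaleR_add_left)
  also have "(\<Sum>k=1..M. if k = j then a *\<^sub>R e k else 0) = a *\<^sub>R x"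
    using j by (simp add: M_def)
  also have "(\<Sum>k=1..M. if k \<le> N then c k *\<^sub>R e k else 0) = z"
    unfolding z by (intro sum.mono_neutral_cong_right) (auto simp: M_def)
  finally show ?case by metis
qed

lemma parseval_identity:
  fixes e :: "nat \<Rightarrow> 'h::real_inner"
  assumes e: "complete_orthonormal e"
  shows "(\<lambda>N. \<Sum>k=1..N. (inner x (e k))\<^sup>2) \<longlonglongrightarrow> (norm x)\<^sup>2"
proof (rule LIMSEQ_I)
  fix r :: real assume r: "0 < r"
  have "x \<in> closure (span (e ` {1..}))" using e by (simp add: complete_orthonormal_def)
  then obtain z where z: "z \<in> span (e ` {1..})" "dist z x < sqrt r"
    using r unfolding closure_approachable by (meson real_sqrt_gt_zero)
  then obtain N c where Nc: "z = (\<Sum>k=1..N. c k *\<^sub>R e k)" using span_sequence_imp_finite_sum by blast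
  have "(norm (x - z))\<^sup>2 < (sqrt r)\<^sup>2"
    using z(2) by (intro power_strict_mono) (auto simp: dist_norm norm_minus_commute)
  moreover have "(norm x)\<^sup>2 - (\<Sum>k=1..N. (inner x (e k))\<^sup>2) \<le> (norm (x - z))\<^sup>2"
    unfolding Nc orthonormal_approximation_error[OF e] by (simp add: sum_nonneg)
  ultimately have *: "(norm x)\<^sup>2 - (\<Sum>k=1..N. (inner x (e k))\<^sup>2) < r" using r by simp
  show "\<exists>N. \<forall>n\<ge>N. norm ((\<Sum>k=1..n. (inner x (e k))\<^sup>2) - (norm x)\<^sup>2) < r"
  proof (intro exI allI impI)
    fix n assume n: "N \<le> n"
    have "(\<Sum>k=1..N. (inner x (e k))\<^sup>2) \<le> (\<Sum>k=1..n. (inner x (e k))\<^sup>2)"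
      using n by (intro sum_mono2) auto
    with * bessel_inequality[OF e, where x = x and N = n]
    show "norm ((\<Sum>k=1..n. (inner x (e k))\<^sup>2) - (norm x)\<^sup>2) < r" by simp
  qed
qed

lemma complete_orthonormal_eqI:
  fixes e :: "nat \<Rightarrow> 'h::real_inner"
  assumes "complete_orthonormal e" "\<And>k. 1 \<le> k \<Longrightarrow> inner x (e k) = inner y (e k)"
  shows "x = y"
proof -
  have "(\<Sum>k=1..N. (inner (x - y) (e k))\<^sup>2) = 0" for N
    using assms(2) by (simp add: inner_diff_left)
  then have "(norm (x - y))\<^sup>2 = 0"
    using parseval_identity[OF assms(1), of "x - y"] by (simp add: LIMSEQ_const_iff)
  then show ?thesis by simp
qed

text \<open>Both sides are continuous and linear in \<open>x\<close> and agree on the basis, whose span is dense.\<close>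
lemma bounded_linear_diagonal_inner:
  fixes e :: "nat \<Rightarrow> 'h::real_inner"
  assumes e: "complete_orthonormal e" and F: "bounded_linear F"
    and diag: "\<And>j. 1 \<le> j \<Longrightarrow> F (e j) = c j *\<^sub>R e j" and k: "1 \<le> k"
  shows "inner (F x) (e k) = c k * inner x (e k)"
proof -
  interpret F: bounded_linear F by fact
  have span: "inner (F z) (e k) = c k * inner z (e k)" if "z \<in> span (e ` {1..})" for z
    using that
  proof (induction rule: span_induct_alt)
    case base
    then show ?case by (simp add: F.zero)
  next
    case (step a z w)
    then obtain j where j: "1 \<le> j" "z = e j" by auto
    then have "inner (F z) (e k) = c k * inner z (e k)"
      using k by (simp add: diag complete_orthonormal_inner[OF e] del: One_nat_def)
    with step.IH show ?case
      by (simp add: F.add F.scaleR inner_add_left algebra_simps)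
  qed
  have cont: "continuous_on UNIV (\<lambda>z. inner (F z) (e k) - c k * inner z (e k))"
    by (intro continuous_intros F.continuous_on)
  have "x \<in> closure (span (e ` {1..}))" using e by (simp add: complete_orthonormal_def)
  then have "inner (F x) (e k) - c k * inner x (e k) = 0"
    by (rule continuous_constant_on_closure[OF continuous_on_subset[OF cont], rotated -1]) (auto simp: span)
  then show ?thesis by simp
qed

section \<open>The controlled system in coordinates\<close>

text \<open>Coordinates are indexed from 1; the index 1 is kept from being rewritten to a successor.\<close>
declare One_nat_def [simp del]

locale diagonal_control_system =
  fixes e :: "nat \<Rightarrow> 'h::{real_inner, banach, second_countable_topology}"
    and S :: "real \<Rightarrow> 'h \<Rightarrow> 'h" and B :: "'h \<Rightarrow> 'h" and \<alpha> lam :: "nat \<Rightarrow> real"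
  assumes orthonormal: "complete_orthonormal e"
    and S_linear: "\<And>t. 0 \<le> t \<Longrightarrow> bounded_linear (S t)"
    and S_diagonal: "\<And>t k. 0 \<le> t \<Longrightarrow> 1 \<le> k \<Longrightarrow> S t (e k) = exp (- \<alpha> k * t) *\<^sub>R e k"
    and B_linear: "bounded_linear B"
    and B_diagonal: "\<And>k. 1 \<le> k \<Longrightarrow> B (e k) = lam k *\<^sub>R e k"
    and \<alpha>_pos: "\<And>k. 1 \<le> k \<Longrightarrow> 0 < \<alpha> k"
    and lam_pos: "\<And>k. 1 \<le> k \<Longrightarrow> 0 < lam k"
begin

abbreviation u where "u \<equiv> feedback e \<alpha> lam"

text \<open>The \<open>k\<close>-th coordinate of \<open>B (v - u(y))\<close>, the inhomogeneity in the equation of the \<open>k\<close>-th coordinate.\<close>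
definition forcing :: "nat \<Rightarrow> (real \<Rightarrow> 'h) \<Rightarrow> (real \<Rightarrow> 'h) \<Rightarrow> real \<Rightarrow> real" where
  "forcing k v y s = lam k * inner (v s) (e k) - (if k = 1 then 2 * \<alpha> 1 else 0) * inner (y s) (e 1)"

text \<open>The least action, per squared distance, of reaching a point of the line spanned by \<open>e 1\<close> at time \<open>t\<close>
  along that line. In hyperbolic form it is \<open>(\<alpha>\<^sub>1/(2 \<lambda>\<^sub>1\<^sup>2)) (3 + coth (\<alpha>\<^sub>1 t))\<close>.\<close>
definition hitting_cost :: "real \<Rightarrow> real" where
  "hitting_cost t = \<alpha> 1 / (lam 1)\<^sup>2 * (1 + 1 / (1 - exp (- 2 * \<alpha> 1 * t)))"

lemma e_unit: "norm (e k) = 1" if "1 \<le> k"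
  using orthonormal that by (rule complete_orthonormal_norm)

lemma norm_feedback_power2: "(norm (u x))\<^sup>2 = (2 * \<alpha> 1 / lam 1)\<^sup>2 * (inner x (e 1))\<^sup>2"
  using e_unit[of 1] by (simp add: feedback_def power_mult_distrib power_divide)

lemma closed_loop_coordinate:
  assumes "1 \<le> k" "0 \<le> t"
  shows "inner (S t (B (v s - u (y s)))) (e k) = exp (- \<alpha> k * t) * forcing k v y s"
proof -
  have "inner (u (y s)) (e k) = (if k = 1 then 2 * \<alpha> 1 / lam 1 * inner (y s) (e 1) else 0)"
    using assms by (simp add: feedback_def complete_orthonormal_inner[OF orthonormal])
  then show ?thesis
    using assms lam_pos[of 1]
    by (simp add: bounded_linear_diagonal_inner[OF orthonormal S_linear S_diagonal]
        bounded_linear_diagonal_inner[OF orthonormal B_linear B_diagonal]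
        forcing_def inner_diff_left algebra_simps)
qed

lemma mild_solution_coordinate:
  assumes "mild_solution S B u T v y" "1 \<le> k" "t \<in> {0..T}"
  shows "inner (y t) (e k) = (LINT s:{0..t}|lborel. exp (- \<alpha> k * (t - s)) * forcing k v y s)"
proof -
  have int: "set_integrable lborel {0..t} (\<lambda>s. S (t - s) (B (v s - u (y s))))"
    and yt: "y t = (LINT s:{0..t}|lborel. S (t - s) (B (v s - u (y s))))"
    using assms by (auto simp: mild_solution_def)
  have "inner (y t) (e k) =
      (\<integral>s. inner (indicator {0..t} s *\<^sub>R S (t - s) (B (v s - u (y s)))) (e k) \<partial>lborel)"
    unfolding yt set_lebesgue_integral_def
    using int by (intro integral_inner_left[symmetric]) (simp add: set_integrable_def)
  also have "\<dots> = (LINT s:{0..t}|lborel. exp (- \<alpha> k * (t - s)) * forcing k v y s)"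
    unfolding set_lebesgue_integral_def
    by (intro Bochner_Integration.integral_cong refl)
      (use assms(2) in \<open>auto simp: closed_loop_coordinate indicator_def\<close>)
  finally show ?thesis .
qed

lemma L2_control_forcing:
  assumes "L2_control T v" "continuous_on {0..T} y"
  shows "L2_control T (forcing k v y)"
  unfolding forcing_def[abs_def]
  by (intro L2_control_linear_combination L2_control_inner L2_control_continuous
      continuous_intros assms)

lemma mild_solution_restrict:
  assumes "mild_solution S B u T v y" "\<tau> \<le> T"
  shows "mild_solution S B u \<tau> v y"
  using assms continuous_on_subset[of "{0..T}" y "{0..\<tau>}"] by (auto simp: mild_solution_def)

text \<open>Substituting \<open>\<lambda>\<^sub>1 v\<^sub>1 = f + 2 \<alpha>\<^sub>1 y\<^sub>1\<close> gives the integrand of \<open>mild_action\<close>. The identity serves both the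
  lower bound and the evaluation of the action of the extremal path.\<close>
lemma first_coordinate_action:
  assumes v: "L2_control T v" and mild: "mild_solution S B u T v y" and T: "0 \<le> T"
  shows "(LINT s:{0..T}|lborel. 1/2 * (inner (v s) (e 1))\<^sup>2 - (2 * \<alpha> 1 / lam 1)\<^sup>2 * (inner (y s) (e 1))\<^sup>2) =
    ((LINT s:{0..T}|lborel. (forcing 1 v y s)\<^sup>2) + 2 * \<alpha> 1 * (inner (y T) (e 1))\<^sup>2) / (2 * (lam 1)\<^sup>2)"
proof -
  have y: "continuous_on {0..T} y" using mild by (simp add: mild_solution_def)
  have l: "lam 1 > 0" by (simp add: lam_pos)
  have "(LINT s:{0..T}|lborel. 1/2 * (inner (v s) (e 1))\<^sup>2 - (2 * \<alpha> 1 / lam 1)\<^sup>2 * (inner (y s) (e 1))\<^sup>2) =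
    (LINT s:{0..T}|lborel. ((forcing 1 v y s + 2 * \<alpha> 1 * inner (y s) (e 1))\<^sup>2
        - 8 * (\<alpha> 1)\<^sup>2 * (inner (y s) (e 1))\<^sup>2) / (2 * (lam 1)\<^sup>2))"
    using l by (intro set_lebesgue_integral_cong)
      (auto simp: forcing_def power_mult_distrib power_divide field_simps)
  also have "\<dots> = (LINT s:{0..T}|lborel. (forcing 1 v y s + 2 * \<alpha> 1 * inner (y s) (e 1))\<^sup>2
        - 8 * (\<alpha> 1)\<^sup>2 * (inner (y s) (e 1))\<^sup>2) / (2 * (lam 1)\<^sup>2)"
    by (rule set_integral_divide_zero)
  also have "(LINT s:{0..T}|lborel. (forcing 1 v y s + 2 * \<alpha> 1 * inner (y s) (e 1))\<^sup>2
        - 8 * (\<alpha> 1)\<^sup>2 * (inner (y s) (e 1))\<^sup>2) =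
      (LINT s:{0..T}|lborel. (forcing 1 v y s)\<^sup>2) + 2 * \<alpha> 1 * (inner (y T) (e 1))\<^sup>2"
  proof (rule mild_action[OF _ T])
    show "\<alpha> 1 \<noteq> 0" using \<alpha>_pos[of 1] by simp
    show "L2_control T (forcing 1 v y)" using v y by (rule L2_control_forcing)
    show "continuous_on {0..T} (\<lambda>s. inner (y s) (e 1))" by (intro continuous_intros y)
  qed (use mild_solution_coordinate[OF mild, of 1] in simp)
  finally show ?thesis .
qed

lemma first_coordinate_lower_bound:
  assumes v: "L2_control T v" and mild: "mild_solution S B u T v y" and T: "0 < T"
  shows "hitting_cost T * (inner (y T) (e 1))\<^sup>2 \<le>
    (LINT s:{0..T}|lborel. 1/2 * (inner (v s) (e 1))\<^sup>2 - (2 * \<alpha> 1 / lam 1)\<^sup>2 * (inner (y s) (e 1))\<^sup>2)"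
proof -
  have y: "continuous_on {0..T} y" using mild by (simp add: mild_solution_def)
  have l: "lam 1 > 0" by (simp add: lam_pos)
  have a: "0 < \<alpha> 1" by (simp add: \<alpha>_pos)
  define q where "q = 1 - exp (- 2 * \<alpha> 1 * T)"
  have q: "0 < q" using a T by (simp add: q_def)
  have "2 * \<alpha> 1 / q * (inner (y T) (e 1))\<^sup>2 \<le> (LINT s:{0..T}|lborel. (forcing 1 v y s)\<^sup>2)"
    using mild_forcing_lower_bound[OF a T L2_control_forcing[OF v y, of 1]]
      mild_solution_coordinate[OF mild, of 1 T] T by (simp add: q_def)
  then have "(2 * \<alpha> 1 / q * (inner (y T) (e 1))\<^sup>2 + 2 * \<alpha> 1 * (inner (y T) (e 1))\<^sup>2) / (2 * (lam 1)\<^sup>2)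
      \<le> ((LINT s:{0..T}|lborel. (forcing 1 v y s)\<^sup>2) + 2 * \<alpha> 1 * (inner (y T) (e 1))\<^sup>2) / (2 * (lam 1)\<^sup>2)"
    by (intro divide_right_mono add_right_mono) auto
  moreover have "(2 * \<alpha> 1 / q * (inner (y T) (e 1))\<^sup>2 + 2 * \<alpha> 1 * (inner (y T) (e 1))\<^sup>2) / (2 * (lam 1)\<^sup>2)
      = hitting_cost T * (inner (y T) (e 1))\<^sup>2"
    unfolding hitting_cost_def q_def[symmetric] using l q by (simp add: field_simps)
  ultimately show ?thesis
    using first_coordinate_action[OF v mild] T by simp
qed

text \<open>The feedback does not act here, so Cauchy-Schwarz applies to the control directly. The factor
  \<open>1/(1 - exp (- 2 \<alpha>\<^sub>k T)) \<ge> 1\<close> is discarded to obtain a bound that is uniform in \<open>T\<close>.\<close>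
lemma higher_coordinate_lower_bound:
  assumes v: "L2_control T v" and mild: "mild_solution S B u T v y" and T: "0 < T" and k: "2 \<le> k"
  shows "\<alpha> k / (lam k)\<^sup>2 * (inner (y T) (e k))\<^sup>2 \<le> (LINT s:{0..T}|lborel. 1/2 * (inner (v s) (e k))\<^sup>2)"
proof -
  have y: "continuous_on {0..T} y" using mild by (simp add: mild_solution_def)
  have l: "lam k > 0" and a: "0 < \<alpha> k" using k by (auto simp: lam_pos \<alpha>_pos)
  define q where "q = 1 - exp (- 2 * \<alpha> k * T)"
  have q: "0 < q" "q \<le> 1" using a T by (auto simp: q_def)
  have "2 * \<alpha> k \<le> 2 * \<alpha> k / q" using q a by (simp add: field_simps)
  then have "2 * \<alpha> k * (inner (y T) (e k))\<^sup>2 \<le> 2 * \<alpha> k / q * (inner (y T) (e k))\<^sup>2"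
    by (rule mult_right_mono) simp
  also have "\<dots> \<le> (LINT s:{0..T}|lborel. (forcing k v y s)\<^sup>2)"
    using mild_forcing_lower_bound[OF a T L2_control_forcing[OF v y, of k]]
      mild_solution_coordinate[OF mild, of k T] T k by (simp add: q_def)
  also have "\<dots> = (LINT s:{0..T}|lborel. 2 * (lam k)\<^sup>2 * (1/2 * (inner (v s) (e k))\<^sup>2))"
    using k by (intro set_lebesgue_integral_cong) (auto simp: forcing_def power_mult_distrib)
  also have "\<dots> = 2 * (lam k)\<^sup>2 * (LINT s:{0..T}|lborel. 1/2 * (inner (v s) (e k))\<^sup>2)"
    by (rule set_integral_mult_right)
  finally show ?thesis using l by (simp add: field_simps)
qed

lemma running_cost_integrable:
  assumes v: "L2_control T v" and y: "continuous_on {0..T} y"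
  shows "set_integrable lborel {0..T} (\<lambda>s. 1/2 * (norm (v s))\<^sup>2 - (norm (u (y s)))\<^sup>2)"
proof -
  have "set_integrable lborel {0..T} (\<lambda>s. 1/2 * (norm (v s))\<^sup>2)"
    using v by (intro set_integrable_mult_right) (simp add: L2_control_def)
  moreover have "set_integrable lborel {0..T} (\<lambda>s. (norm (u (y s)))\<^sup>2)"
    unfolding norm_feedback_power2 by (intro borel_integrable_atLeastAtMost' continuous_intros y)
  ultimately show ?thesis by (rule set_integral_diff)
qed

text \<open>The bounds of the first \<open>N\<close> coordinates are added. Bessel's inequality controls the truncated action by the
  full one, and Parseval's identity recovers the norm of \<open>y(T)\<close> as \<open>N\<close> tends to infinity.\<close>
lemma action_lower_bound:
  assumes v: "L2_control T v" and mild: "mild_solution S B u T v y" and T: "0 < T"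
    and c1: "c \<le> hitting_cost T" and ck: "\<And>k. 2 \<le> k \<Longrightarrow> c \<le> \<alpha> k / (lam k)\<^sup>2"
  shows "c * (norm (y T))\<^sup>2 \<le> (LINT s:{0..T}|lborel. 1/2 * (norm (v s))\<^sup>2 - (norm (u (y s)))\<^sup>2)"
    (is "_ \<le> ?I")
proof -
  have y: "continuous_on {0..T} y" using mild by (simp add: mild_solution_def)
  define J where "J k s = 1/2 * (inner (v s) (e k))\<^sup>2 -
      (if k = 1 then (2 * \<alpha> 1 / lam 1)\<^sup>2 * (inner (y s) (e 1))\<^sup>2 else 0)" for k s
  have J: "set_integrable lborel {0..T} (J k)" if "1 \<le> k" for k
  proof -
    have "set_integrable lborel {0..T} (\<lambda>s. if k = 1 then (2 * \<alpha> 1 / lam 1)\<^sup>2 * (inner (y s) (e 1))\<^sup>2 else 0)"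
      by (cases "k = 1")
        (auto intro!: borel_integrable_atLeastAtMost' continuous_intros y simp del: set_integrable_mult_right)
    then show ?thesis
      unfolding J_def[abs_def] using that v
      by (intro set_integral_diff set_integrable_mult_right L2_control_power2_integrable
          L2_control_inner) auto
  qed
  have Jk: "c * (inner (y T) (e k))\<^sup>2 \<le> (LINT s:{0..T}|lborel. J k s)" if "1 \<le> k" for k
  proof (cases "k = 1")
    case True
    have "c * (inner (y T) (e 1))\<^sup>2 \<le> hitting_cost T * (inner (y T) (e 1))\<^sup>2"
      by (intro mult_right_mono c1) simp
    then show ?thesis
      using first_coordinate_lower_bound[OF v mild T] True by (simp add: J_def)
  next
    case False
    then have k: "2 \<le> k" using that by simp
    have "c * (inner (y T) (e k))\<^sup>2 \<le> \<alpha> k / (lam k)\<^sup>2 * (inner (y T) (e k))\<^sup>2"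
      by (intro mult_right_mono ck k) simp
    also note higher_coordinate_lower_bound[OF v mild T k]
    finally show ?thesis using False by (simp add: J_def)
  qed
  have "(\<lambda>N. c * (\<Sum>k=1..N. (inner (y T) (e k))\<^sup>2)) \<longlonglongrightarrow> c * (norm (y T))\<^sup>2"
    by (intro tendsto_mult_left parseval_identity orthonormal)
  then show ?thesis
  proof (rule LIMSEQ_le_const2, intro exI[of _ 1] allI impI)
    fix N :: nat assume N: "1 \<le> N"
    have "c * (\<Sum>k=1..N. (inner (y T) (e k))\<^sup>2) \<le> (\<Sum>k=1..N. LINT s:{0..T}|lborel. J k s)"
      unfolding sum_distrib_left by (intro sum_mono Jk) auto
    also have "\<dots> = (\<integral>s. (\<Sum>k=1..N. indicator {0..T} s *\<^sub>R J k s) \<partial>lborel)"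
      unfolding set_lebesgue_integral_def
      using J by (intro Bochner_Integration.integral_sum[symmetric]) (auto simp: set_integrable_def)
    also have "\<dots> \<le> ?I"
      unfolding set_lebesgue_integral_def
    proof (rule integral_mono)
      show "integrable lborel (\<lambda>s. \<Sum>k=1..N. indicator {0..T} s *\<^sub>R J k s)"
        using J by (intro Bochner_Integration.integrable_sum) (auto simp: set_integrable_def)
      show "integrable lborel (\<lambda>s. indicator {0..T} s *\<^sub>R (1/2 * (norm (v s))\<^sup>2 - (norm (u (y s)))\<^sup>2))"
        using running_cost_integrable[OF v y] by (simp add: set_integrable_def)
      fix s
      have "(\<Sum>k=1..N. J k s) = 1/2 * (\<Sum>k=1..N. (inner (v s) (e k))\<^sup>2) - (norm (u (y s)))\<^sup>2"
        using N by (simp add: J_def sum_subtractf sum_distrib_left norm_feedback_power2)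
      also have "\<dots> \<le> 1/2 * (norm (v s))\<^sup>2 - (norm (u (y s)))\<^sup>2"
        using bessel_inequality[OF orthonormal, where x = "v s" and N = N] by simp
      finally show "(\<Sum>k=1..N. indicator {0..T} s *\<^sub>R J k s)
          \<le> indicator {0..T} s *\<^sub>R (1/2 * (norm (v s))\<^sup>2 - (norm (u (y s)))\<^sup>2)"
        by (simp add: scaleR_sum_right[symmetric] indicator_def del: scaleR_sum_right)
    qed
    finally show "c * (\<Sum>k=1..N. (inner (y T) (e k))\<^sup>2) \<le> ?I" .
  qed
qed

text \<open>The path determines each coordinate of the forcing almost everywhere, hence all countably many of them
  simultaneously, and the forcing together with the path determines the control.\<close>
lemma control_unique:
  assumes v: "L2_control T v" and mv: "mild_solution S B u T v y"
    and w: "L2_control T w" and mw: "mild_solution S B u T w y"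
  shows "AE s in lborel. s \<in> {0..T} \<longrightarrow> v s = w s"
proof -
  have y: "continuous_on {0..T} y" using mv by (simp add: mild_solution_def)
  have "AE s in lborel. s \<in> {0..T} \<longrightarrow> forcing k v y s = forcing k w y s" if k: "1 \<le> k" for k
    by (rule mild_forcing_unique[where a = "\<alpha> k", OF
          L2_control_integrable[OF L2_control_forcing[OF v y]]
          L2_control_integrable[OF L2_control_forcing[OF w y]]])
      (simp only: mild_solution_coordinate[OF mv k, symmetric] mild_solution_coordinate[OF mw k, symmetric])
  then have "AE s in lborel. \<forall>k\<in>{1..}. s \<in> {0..T} \<longrightarrow> forcing k v y s = forcing k w y s"
    by (intro AE_ball_countable[THEN iffD2]) auto
  then show ?thesis
  proof eventually_elim
    case (elim s)
    show ?case
    proof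
      assume "s \<in> {0..T}"
      with elim have eq: "forcing k v y s = forcing k w y s" if "1 \<le> k" for k using that by simp
      show "v s = w s"
      proof (rule complete_orthonormal_eqI[OF orthonormal])
        fix k :: nat assume "1 \<le> k"
        then show "inner (v s) (e k) = inner (w s) (e k)"
          using eq[of k] lam_pos[of k] by (simp add: forcing_def)
      qed
    qed
  qed
qed

section \<open>The hitting cost\<close>

lemma hitting_cost_antimono:
  assumes "0 < s" "s \<le> t"
  shows "hitting_cost t \<le> hitting_cost s"
proof -
  have a: "0 < \<alpha> 1" by (simp add: \<alpha>_pos)
  have "1 / (1 - exp (- 2 * \<alpha> 1 * t)) \<le> 1 / (1 - exp (- 2 * \<alpha> 1 * s))"
    using a assms by (intro divide_left_mono mult_pos_pos) auto
  then show ?thesis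
    unfolding hitting_cost_def using a by (intro mult_left_mono) auto
qed

lemma hitting_cost_pos: "0 < t \<Longrightarrow> 0 < hitting_cost t"
  using \<alpha>_pos[of 1] lam_pos[of 1] unfolding hitting_cost_def by (intro mult_pos_pos add_pos_pos) auto

lemma hitting_cost_tendsto: "(hitting_cost \<longlongrightarrow> 2 * (\<alpha> 1 / (lam 1)\<^sup>2)) at_top"
proof -
  have a: "0 < \<alpha> 1" by (simp add: \<alpha>_pos)
  have "filterlim (\<lambda>t. 2 * \<alpha> 1 * t) at_top at_top"
    using a by (intro filterlim_tendsto_pos_mult_at_top[OF tendsto_const _ filterlim_ident]) simp
  then have "((\<lambda>t. exp (- (2 * \<alpha> 1 * t))) \<longlongrightarrow> 0) at_top"
    by (intro filterlim_compose[OF exp_at_bot]) (simp add: filterlim_uminus_at_top)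
  then have "((\<lambda>t. \<alpha> 1 / (lam 1)\<^sup>2 * (1 + 1 / (1 - exp (- (2 * \<alpha> 1 * t))))) \<longlongrightarrow>
      \<alpha> 1 / (lam 1)\<^sup>2 * (1 + 1 / (1 - 0))) at_top"
    by (intro tendsto_intros) auto
  then show ?thesis by (simp add: hitting_cost_def[abs_def] mult.commute)
qed

section \<open>The extremal path\<close>

text \<open>The path along \<open>e 1\<close> from 0 to norm \<open>L\<close> that is driven by a forcing proportional to \<open>exp (\<alpha>\<^sub>1 s)\<close>, the
  equality case of the Cauchy-Schwarz estimate. Equivalently, it solves the Euler-Lagrange equation
  \<open>y'' = \<alpha>\<^sub>1\<^sup>2 y\<close>.\<close>
definition sinh_path :: "real \<Rightarrow> real \<Rightarrow> real \<Rightarrow> 'h" where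
  "sinh_path L T t = (L * sinh (\<alpha> 1 * t) / sinh (\<alpha> 1 * T)) *\<^sub>R e 1"

text \<open>The control \<open>(y' + 3 \<alpha>\<^sub>1 y)/\<lambda>\<^sub>1\<close> of that path, where \<open>3 \<alpha>\<^sub>1\<close> collects the decay \<open>\<alpha>\<^sub>1\<close> of the semigroup and the
  \<open>2 \<alpha>\<^sub>1\<close> of the feedback, and \<open>cosh + sinh = exp\<close> has been used.\<close>
definition sinh_control :: "real \<Rightarrow> real \<Rightarrow> real \<Rightarrow> 'h" where
  "sinh_control L T t = (L * \<alpha> 1 / lam 1 * (exp (\<alpha> 1 * t) + 2 * sinh (\<alpha> 1 * t)) / sinh (\<alpha> 1 * T)) *\<^sub>R e 1"

lemma sinh_path_coordinate:
  assumes "1 \<le> k"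
  shows "inner (sinh_path L T t) (e k) = (if k = 1 then L * sinh (\<alpha> 1 * t) / sinh (\<alpha> 1 * T) else 0)"
  using assms by (simp add: sinh_path_def complete_orthonormal_inner[OF orthonormal])

lemma continuous_sinh_path: "continuous_on A (sinh_path L T)"
  unfolding sinh_path_def[abs_def] divide_inverse by (intro continuous_intros)

lemma sinh_pos: "0 < t \<Longrightarrow> 0 < sinh (\<alpha> 1 * t)"
  using \<alpha>_pos[of 1] by simp

lemma norm_sinh_path:
  assumes "0 < L" "0 < T" "0 \<le> t"
  shows "norm (sinh_path L T t) = L * sinh (\<alpha> 1 * t) / sinh (\<alpha> 1 * T)"
  using assms \<alpha>_pos[of 1] e_unit[of 1] sinh_pos[of T] by (simp add: sinh_path_def)

lemma norm_sinh_path_final: "0 < L \<Longrightarrow> 0 < T \<Longrightarrow> norm (sinh_path L T T) = L"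
  using norm_sinh_path[of L T T] sinh_pos[of T] \<alpha>_pos[of 1] by simp

lemma norm_sinh_path_less:
  assumes "0 < L" "0 < T" "0 \<le> t" "t < T"
  shows "norm (sinh_path L T t) < L"
proof -
  have "sinh (\<alpha> 1 * t) < sinh (\<alpha> 1 * T)" using assms \<alpha>_pos[of 1] by simp
  then show ?thesis
    using assms norm_sinh_path[of L T t] sinh_pos[of T] by (simp add: field_simps)
qed

lemma sinh_path_admissible:
  assumes "0 < L" "0 < T"
  shows "sinh_path L T \<in> admissible_paths L T"
proof -
  have "sinh_path L T 0 = 0" by (simp add: sinh_path_def)
  then show ?thesis
    using continuous_sinh_path norm_sinh_path_final[OF assms] assms
    by (auto simp: admissible_paths_def)
qed

lemma exit_time_sinh_path:
  assumes "0 < L" "0 < T"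
  shows "exit_time L T (sinh_path L T) = T"
proof -
  have "{t. 0 < t \<and> t \<le> T \<and> L \<le> norm (sinh_path L T t)} = {T}"
    using norm_sinh_path_less[OF assms] norm_sinh_path_final[OF assms] assms
    by (auto simp: not_less[symmetric] intro: antisym) (meson less_eq_real_def not_less)+
  then show ?thesis by (simp add: exit_time_def)
qed

lemma L2_control_sinh: "L2_control T' (sinh_control L T)"
  unfolding sinh_control_def[abs_def] divide_inverse by (intro L2_control_continuous continuous_intros)

lemma forcing_sinh:
  "forcing 1 (sinh_control L T) (sinh_path L T) t = L * \<alpha> 1 / sinh (\<alpha> 1 * T) * exp (\<alpha> 1 * t)"
proof -
  have "lam 1 * (L * \<alpha> 1 / lam 1 * (x + 2 * s) / r) - 2 * \<alpha> 1 * (L * s / r) = L * \<alpha> 1 / r * x" for x s r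
    using lam_pos[of 1] by (cases "r = 0") (simp_all add: field_simps)
  then show ?thesis
    using e_unit[of 1] by (simp only: forcing_def sinh_control_def sinh_path_def norm_eq_1) simp
qed

lemma mild_solution_sinh: "mild_solution S B u T (sinh_control L T) (sinh_path L T)"
proof -
  have a: "\<alpha> 1 \<noteq> 0" using \<alpha>_pos[of 1] by simp
  define C where "C = L * \<alpha> 1 / sinh (\<alpha> 1 * T)"
  have integrand: "S (t - s) (B (sinh_control L T s - u (sinh_path L T s))) =
      (C * exp (- \<alpha> 1 * t) * exp (2 * \<alpha> 1 * s)) *\<^sub>R e 1" if "s \<in> {0..t}" for s t
  proof (rule complete_orthonormal_eqI[OF orthonormal])
    fix k :: nat assume k: "1 \<le> k"
    have "exp (- \<alpha> 1 * (t - s)) * exp (\<alpha> 1 * s) = exp (- \<alpha> 1 * t) * exp (2 * \<alpha> 1 * s)"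
      by (simp flip: exp_add add: algebra_simps)
    moreover have "forcing k (sinh_control L T) (sinh_path L T) s = 0" if "k \<noteq> 1"
      using that k by (simp add: forcing_def sinh_control_def complete_orthonormal_inner[OF orthonormal])
    ultimately show "inner (S (t - s) (B (sinh_control L T s - u (sinh_path L T s)))) (e k) =
        inner ((C * exp (- \<alpha> 1 * t) * exp (2 * \<alpha> 1 * s)) *\<^sub>R e 1) (e k)"
      using that k
      by (cases "k = 1")
        (simp_all add: closed_loop_coordinate forcing_sinh complete_orthonormal_inner[OF orthonormal]
          C_def mult_ac)
  qed
  have path_value: "(LINT s:{0..t}|lborel. (C * exp (- \<alpha> 1 * t) * exp (2 * \<alpha> 1 * s)) *\<^sub>R e 1) = sinh_path L T t"
    if t: "t \<in> {0..T}" for t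
  proof -
    have int: "integrable lborel (\<lambda>s. indicator {0..t} s *\<^sub>R (C * exp (- \<alpha> 1 * t) * exp (2 * \<alpha> 1 * s)))"
      using borel_integrable_atLeastAtMost'[of 0 t "\<lambda>s. C * exp (- \<alpha> 1 * t) * exp (2 * \<alpha> 1 * s)"]
      by (simp add: set_integrable_def continuous_intros)
    have "(LINT s:{0..t}|lborel. (C * exp (- \<alpha> 1 * t) * exp (2 * \<alpha> 1 * s)) *\<^sub>R e 1) =
        (\<integral>s. (indicator {0..t} s *\<^sub>R (C * exp (- \<alpha> 1 * t) * exp (2 * \<alpha> 1 * s))) *\<^sub>R e 1 \<partial>lborel)"
      unfolding set_lebesgue_integral_def by (intro Bochner_Integration.integral_cong) auto
    also have "\<dots> = (LINT s:{0..t}|lborel. C * exp (- \<alpha> 1 * t) * exp (2 * \<alpha> 1 * s)) *\<^sub>R e 1"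
      unfolding set_lebesgue_integral_def by (rule integral_scaleR_left) (rule int)
    also have "(LINT s:{0..t}|lborel. C * exp (- \<alpha> 1 * t) * exp (2 * \<alpha> 1 * s)) =
        C * exp (- \<alpha> 1 * t) * ((exp (2 * \<alpha> 1 * t) - 1) / (2 * \<alpha> 1))"
      unfolding set_integral_mult_right by (subst integral_exp_linear) (use a t in auto)
    also have "\<dots> = L * sinh (\<alpha> 1 * t) / sinh (\<alpha> 1 * T)"
    proof -
      have "exp (- \<alpha> 1 * t) * (exp (2 * \<alpha> 1 * t) - 1) = 2 * sinh (\<alpha> 1 * t)"
        by (simp add: right_diff_distrib sinh_def flip: exp_add)
      then have "C * exp (- \<alpha> 1 * t) * ((exp (2 * \<alpha> 1 * t) - 1) / (2 * \<alpha> 1)) = C * sinh (\<alpha> 1 * t) / \<alpha> 1"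
        using a by (simp add: field_simps)
      then show ?thesis using a by (simp add: C_def)
    qed
    finally show ?thesis by (simp add: sinh_path_def)
  qed
  show ?thesis
    unfolding mild_solution_def
  proof (intro conjI ballI continuous_sinh_path)
    fix t assume t: "t \<in> {0..T}"
    have "set_integrable lborel {0..t} (\<lambda>s. (C * exp (- \<alpha> 1 * t) * exp (2 * \<alpha> 1 * s)) *\<^sub>R e 1)"
      by (intro borel_integrable_atLeastAtMost' continuous_intros)
    then show "set_integrable lborel {0..t} (\<lambda>s. S (t - s) (B (sinh_control L T s - u (sinh_path L T s))))"
      by (subst set_integrable_cong[OF refl refl integrand]) auto
    show "sinh_path L T t = (LINT s:{0..t}|lborel. S (t - s) (B (sinh_control L T s - u (sinh_path L T s))))"
      unfolding path_value[OF t, symmetric]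
      by (intro set_lebesgue_integral_cong) (auto simp: integrand)
  qed
qed

lemma sinh_action:
  assumes L: "0 < L" and T: "0 < T"
  shows "(LINT s:{0..T}|lborel. 1/2 * (norm (sinh_control L T s))\<^sup>2 - (norm (u (sinh_path L T s)))\<^sup>2) =
    hitting_cost T * L\<^sup>2"
proof -
  have a: "0 < \<alpha> 1" and l: "0 < lam 1" by (auto simp: \<alpha>_pos lam_pos)
  define E where "E = exp (\<alpha> 1 * T)"
  have E: "1 < E" using a T by (simp add: E_def)
  have sinhT: "sinh (\<alpha> 1 * T) = (E - inverse E) / 2" by (simp add: E_def sinh_def exp_minus)
  have E2: "exp (2 * \<alpha> 1 * T) = E\<^sup>2" "exp (- 2 * \<alpha> 1 * T) = inverse (E\<^sup>2)"
    using exp_double[of "\<alpha> 1 * T"] by (simp_all add: E_def exp_minus mult.assoc)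
  have "(LINT s:{0..T}|lborel. (forcing 1 (sinh_control L T) (sinh_path L T) s)\<^sup>2) =
      (LINT s:{0..T}|lborel. (L * \<alpha> 1 / sinh (\<alpha> 1 * T))\<^sup>2 * exp (2 * \<alpha> 1 * s))"
    using exp_double[of "\<alpha> 1 * s" for s]
    by (intro set_lebesgue_integral_cong) (auto simp: forcing_sinh power_mult_distrib power_divide mult.assoc)
  also have "\<dots> = (L * \<alpha> 1 / sinh (\<alpha> 1 * T))\<^sup>2 * ((E\<^sup>2 - 1) / (2 * \<alpha> 1))"
    unfolding set_integral_mult_right E2(1)[symmetric] by (subst integral_exp_linear) (use a T in auto)
  also have "\<dots> = 2 * \<alpha> 1 / (1 - inverse (E\<^sup>2)) * L\<^sup>2"
  proof -
    have algebra: "(L * r / (w / (2 * E)))\<^sup>2 * (w / (2 * r)) = 2 * r / (w / E\<^sup>2) * L\<^sup>2"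
      if "0 < w" "0 < r" for w r
      using that E by (simp add: field_simps power2_eq_square)
    have "E\<^sup>2 - 1 > 0" using E by simp
    moreover have "sinh (\<alpha> 1 * T) = (E\<^sup>2 - 1) / (2 * E)"
      unfolding sinhT using E by (simp add: field_simps power2_eq_square)
    moreover have "1 - inverse (E\<^sup>2) = (E\<^sup>2 - 1) / E\<^sup>2" using E by (simp add: field_simps)
    ultimately show ?thesis using algebra[OF _ a] by simp
  qed
  finally have f: "(LINT s:{0..T}|lborel. (forcing 1 (sinh_control L T) (sinh_path L T) s)\<^sup>2) =
      2 * \<alpha> 1 / (1 - exp (- 2 * \<alpha> 1 * T)) * L\<^sup>2" unfolding E2 .
  have "(LINT s:{0..T}|lborel. 1/2 * (norm (sinh_control L T s))\<^sup>2 - (norm (u (sinh_path L T s)))\<^sup>2) =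
    (LINT s:{0..T}|lborel. 1/2 * (inner (sinh_control L T s) (e 1))\<^sup>2
       - (2 * \<alpha> 1 / lam 1)\<^sup>2 * (inner (sinh_path L T s) (e 1))\<^sup>2)"
    unfolding norm_feedback_power2
    using e_unit[of 1] complete_orthonormal_inner[OF orthonormal, of 1 1]
    by (simp add: sinh_control_def power_mult_distrib power_divide)
  also have "\<dots> = (2 * \<alpha> 1 / (1 - exp (- 2 * \<alpha> 1 * T)) * L\<^sup>2 + 2 * \<alpha> 1 * L\<^sup>2) / (2 * (lam 1)\<^sup>2)"
    using first_coordinate_action[OF L2_control_sinh mild_solution_sinh, of T L] T sinh_pos[OF T]
    by (simp add: f sinh_path_coordinate)
  also have "\<dots> = hitting_cost T * L\<^sup>2"
  proof -
    define q where "q = 1 - exp (- 2 * \<alpha> 1 * T)"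
    have "0 < q" using a T by (simp add: q_def)
    then show ?thesis
      unfolding hitting_cost_def q_def[symmetric] using l by (simp add: field_simps)
  qed
  finally show ?thesis .
qed

text \<open>The control selected by the choice operator agrees with the explicit one almost everywhere, so both have
  the same action.\<close>
lemma rate_functional_sinh_path:
  assumes L: "0 < L" and T: "0 < T"
  shows "rate_functional S B u L T (sinh_path L T) = ereal (hitting_cost T * L\<^sup>2)"
proof -
  let ?y = "sinh_path L T" and ?w = "sinh_control L T"
  let ?P = "\<lambda>v. L2_control T v \<and> mild_solution S B u T v ?y"
  define v where "v = (SOME v. ?P v)"
  have ex: "\<exists>v. ?P v" using L2_control_sinh mild_solution_sinh by blast
  then have v: "?P v" unfolding v_def by (rule someI_ex)
  have "(LINT s:{0..T}|lborel. 1/2 * (norm (v s))\<^sup>2 - (norm (u (?y s)))\<^sup>2) =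
      (LINT s:{0..T}|lborel. 1/2 * (norm (?w s))\<^sup>2 - (norm (u (?y s)))\<^sup>2)"
    unfolding set_lebesgue_integral_def
  proof (rule integral_cong_AE)
    show "(\<lambda>s. indicator {0..T} s *\<^sub>R (1/2 * (norm (v s))\<^sup>2 - (norm (u (?y s)))\<^sup>2)) \<in> borel_measurable lborel"
      using running_cost_integrable[OF conjunct1[OF v] continuous_sinh_path] by (simp add: set_integrable_def)
    show "(\<lambda>s. indicator {0..T} s *\<^sub>R (1/2 * (norm (?w s))\<^sup>2 - (norm (u (?y s)))\<^sup>2)) \<in> borel_measurable lborel"
      using running_cost_integrable[OF L2_control_sinh continuous_sinh_path, of T] by (simp add: set_integrable_def)
    have "AE s in lborel. s \<in> {0..T} \<longrightarrow> v s = ?w s"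
      using v by (intro control_unique[OF _ _ L2_control_sinh mild_solution_sinh]) auto
    then show "AE s in lborel. indicator {0..T} s *\<^sub>R (1/2 * (norm (v s))\<^sup>2 - (norm (u (?y s)))\<^sup>2) =
        indicator {0..T} s *\<^sub>R (1/2 * (norm (?w s))\<^sup>2 - (norm (u (?y s)))\<^sup>2)"
      by eventually_elim (auto simp: indicator_def)
  qed
  then show ?thesis
    using ex sinh_action[OF L T]
    by (simp add: rate_functional_def Let_def v_def[symmetric] exit_time_sinh_path[OF L T])
qed

section \<open>The lower bound for admissible paths\<close>

text \<open>Since the path starts at 0 and \<open>L > 0\<close>, requiring \<open>t > 0\<close> is the same as \<open>t \<ge> 0\<close>, so the times at which the norm is at
  least \<open>L\<close> form a closed set and the infimum is attained.\<close>
lemma exit_time_hits: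
  assumes y: "y \<in> admissible_paths L T" and L: "0 < L"
  shows "0 < exit_time L T y" "exit_time L T y \<le> T" "L \<le> norm (y (exit_time L T y))"
proof -
  let ?A = "{t. 0 < t \<and> t \<le> T \<and> L \<le> norm (y t)}"
  have cont: "continuous_on {0..T} y" and y0: "y 0 = 0" using y by (auto simp: admissible_paths_def)
  obtain t where t: "t \<in> {0..T}" "norm (y t) = L" using y by (auto simp: admissible_paths_def)
  with y0 L have "t \<in> ?A" by (cases "t = 0") auto
  have A: "?A = {t \<in> {0..T}. L \<le> norm (y t)}"
    using y0 L by (auto simp: le_less)
  have "closed ?A"
    unfolding A by (intro continuous_on_closed_Collect_le continuous_intros cont closed_atLeastAtMost)
  moreover have "bdd_below ?A" by (intro bdd_belowI[of _ 0]) auto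
  ultimately have "Inf ?A \<in> ?A"
    using \<open>t \<in> ?A\<close> by (intro closed_contains_Inf) auto
  moreover have "exit_time L T y = Inf ?A" using \<open>t \<in> ?A\<close> by (auto simp: exit_time_def)
  ultimately show "0 < exit_time L T y" "exit_time L T y \<le> T" "L \<le> norm (y (exit_time L T y))"
    by auto
qed

text \<open>The action up to the exit time \<open>\<tau>\<close> is at least \<open>c(T)\<close> times the squared norm of \<open>y(\<tau>)\<close>, because
  \<open>c(T) \<le> c(\<tau>)\<close>: exiting early never pays.\<close>
lemma rate_functional_lower_bound:
  assumes y: "y \<in> admissible_paths L T" and L: "0 < L" and T: "0 < T"
    and gap: "\<And>k. 2 \<le> k \<Longrightarrow> hitting_cost T \<le> \<alpha> k / (lam k)\<^sup>2"
  shows "ereal (hitting_cost T * L\<^sup>2) \<le> rate_functional S B u L T y"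
proof (cases "\<exists>v. L2_control T v \<and> mild_solution S B u T v y")
  case True
  let ?P = "\<lambda>v. L2_control T v \<and> mild_solution S B u T v y"
  define \<tau> where "\<tau> = exit_time L T y"
  have \<tau>: "0 < \<tau>" "\<tau> \<le> T" "L \<le> norm (y \<tau>)" using exit_time_hits[OF y L] by (auto simp: \<tau>_def)
  define v where "v = (SOME v. ?P v)"
  have v: "?P v" unfolding v_def using True by (rule someI_ex)
  have "hitting_cost T * L\<^sup>2 \<le> hitting_cost T * (norm (y \<tau>))\<^sup>2"
    using L \<tau> hitting_cost_pos[OF T] by (intro mult_left_mono power_mono) auto
  also have "\<dots> \<le> (LINT s:{0..\<tau>}|lborel. 1/2 * (norm (v s))\<^sup>2 - (norm (u (y s)))\<^sup>2)"
    using v \<tau> by (intro action_lower_bound gap hitting_cost_antimono)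
      (auto intro: L2_control_subset mild_solution_restrict)
  finally show ?thesis
    using True by (simp add: rate_functional_def Let_def v_def[symmetric] \<tau>_def[symmetric])
next
  case False
  show ?thesis unfolding rate_functional_def if_not_P[OF False] by simp
qed

end

section \<open>Existence of the minimizer\<close>

text \<open>The reciprocals are the terms of a convergent series, so \<open>\<alpha> k / (lam k)\<^sup>2\<close> exceeds \<open>\<bar>c\<bar> + 1\<close> for all but
  finitely many \<open>k\<close>, and over the remaining ones a minimum is attained.\<close>
lemma summable_inverse_gap:
  fixes \<alpha> lam :: "nat \<Rightarrow> real"
  assumes pos: "\<And>k. 1 \<le> k \<Longrightarrow> 0 < \<alpha> k" "\<And>k. 1 \<le> k \<Longrightarrow> 0 < lam k"
    and summable: "(\<lambda>k. (lam k)\<^sup>2 / \<alpha> k) summable_on {1..}"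
    and gap: "\<And>k. 2 \<le> k \<Longrightarrow> c < \<alpha> k / (lam k)\<^sup>2"
  obtains m where "c < m" "\<And>k. 2 \<le> k \<Longrightarrow> m \<le> \<alpha> k / (lam k)\<^sup>2"
proof -
  define b where "b = \<bar>c\<bar> + 1"
  have b: "0 < b" "c < b" by (auto simp: b_def)
  have "summable (\<lambda>k. (lam (Suc k))\<^sup>2 / \<alpha> (Suc k))"
  proof -
    have "(\<lambda>k. (lam (Suc k))\<^sup>2 / \<alpha> (Suc k)) summable_on UNIV"
    proof -
      have "range Suc = {1..}" by (auto simp: image_iff Suc_le_eq gr0_conv_Suc One_nat_def)
      then show ?thesis
        using summable_on_reindex[of Suc UNIV "\<lambda>k. (lam k)\<^sup>2 / \<alpha> k"] summable
        by (simp add: o_def)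
    qed
    then show ?thesis by (rule summable_on_imp_summable)
  qed
  then have "(\<lambda>k. (lam (Suc k))\<^sup>2 / \<alpha> (Suc k)) \<longlonglongrightarrow> 0" by (rule summable_LIMSEQ_zero)
  then have "\<forall>\<^sub>F k in sequentially. (lam (Suc k))\<^sup>2 / \<alpha> (Suc k) < 1 / b"
    using b by (intro order_tendstoD(2)[where y = 0]) auto
  then obtain N where N: "\<And>k. N \<le> k \<Longrightarrow> (lam (Suc k))\<^sup>2 / \<alpha> (Suc k) < 1 / b"
    by (auto simp: eventually_sequentially)
  define m where "m = Min (insert b ((\<lambda>k. \<alpha> k / (lam k)\<^sup>2) ` {2..N}))"
  show ?thesis
  proof
    show "c < m" unfolding m_def using b gap by auto
    fix k :: nat assume k: "2 \<le> k"
    show "m \<le> \<alpha> k / (lam k)\<^sup>2"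
    proof (cases "k \<le> N")
      case True
      with k show ?thesis unfolding m_def by (intro Min_le) auto
    next
      case False
      then have "(lam k)\<^sup>2 / \<alpha> k < 1 / b" using N[of "k - 1"] k by simp
      then have "b \<le> \<alpha> k / (lam k)\<^sup>2" using b pos[of k] k by (simp add: field_simps)
      moreover have "m \<le> b" unfolding m_def by (intro Min_le) auto
      ultimately show ?thesis by simp
    qed
  qed
qed

theorem theorem3p9:
  fixes e :: "nat \<Rightarrow> 'h::{real_inner, banach, second_countable_topology}"
    and D :: "'h set" and A B :: "'h \<Rightarrow> 'h" and S :: "real \<Rightarrow> 'h \<Rightarrow> 'h"
    and \<alpha> lam :: "nat \<Rightarrow> real" and L :: real
  assumes "complete_orthonormal e"
    and "self_adjoint_op D A"
    and "\<And>k. k \<ge> 1 \<Longrightarrow> e k \<in> D \<and> A (e k) = - \<alpha> k *\<^sub>R e k"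
    and "0 < \<alpha> 1" and "\<And>k. k \<ge> 1 \<Longrightarrow> \<alpha> k \<le> \<alpha> (k + 1)"
    and "generates D A S"
    and "\<And>t k. t \<ge> 0 \<Longrightarrow> k \<ge> 1 \<Longrightarrow> S t (e k) = exp (- \<alpha> k * t) *\<^sub>R e k"
    and "bounded_linear B"
    and "\<And>k. k \<ge> 1 \<Longrightarrow> B (e k) = lam k *\<^sub>R e k" and "\<And>k. k \<ge> 1 \<Longrightarrow> 0 < lam k"
    and "(\<lambda>k. (lam k)\<^sup>2 / \<alpha> k) summable_on {1..}"
    and "0 < L"
    and "\<And>k. k \<ge> 2 \<Longrightarrow> 2 * (\<alpha> 1 / (lam 1)\<^sup>2) < \<alpha> k / (lam k)\<^sup>2"
  shows "\<exists>T0>0. \<forall>T>T0. \<exists>ystar \<in> admissible_paths L T.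
           rate_functional S B (feedback e \<alpha> lam) L T ystar
             = (INF y\<in>admissible_paths L T. rate_functional S B (feedback e \<alpha> lam) L T y) \<and>
           (\<forall>t\<in>{0..<T}. norm (ystar t) < L) \<and> norm (ystar T) = L \<and>
           (\<forall>t\<in>{0..T}. \<forall>k\<ge>2. inner (ystar t) (e k) = 0)"
proof -
  have \<alpha>_pos: "0 < \<alpha> k" if "1 \<le> k" for k
    using that
  proof (induction k rule: dec_induct)
    case (step n)
    then show ?case using assms(5)[of n] by (simp add: Suc_eq_plus1)
  qed (fact assms(4))
  have S_linear: "bounded_linear (S t)" if "0 \<le> t" for t
    using assms(6) that by (simp add: generates_def C0_semigroup_def)
  interpret diagonal_control_system e S B \<alpha> lam
    by (intro diagonal_control_system.intro assms(1,7-10) \<alpha>_pos S_linear)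
  obtain m where m: "2 * (\<alpha> 1 / (lam 1)\<^sup>2) < m" "\<And>k. 2 \<le> k \<Longrightarrow> m \<le> \<alpha> k / (lam k)\<^sup>2"
    using summable_inverse_gap[OF \<alpha>_pos assms(10,11,13)] by blast
  have "\<forall>\<^sub>F t in at_top. hitting_cost t < m"
    using order_tendstoD(2)[OF hitting_cost_tendsto m(1)] .
  then obtain T1 where T1: "\<And>t. T1 \<le> t \<Longrightarrow> hitting_cost t < m"
    by (auto simp: eventually_at_top_linorder)
  show ?thesis
  proof (intro exI[of _ "max T1 1"] conjI allI impI)
    fix T assume "max T1 1 < T"
    then have T: "0 < T" and cost: "hitting_cost T < m" by (auto intro: T1)
    have gap: "hitting_cost T \<le> \<alpha> k / (lam k)\<^sup>2" if "2 \<le> k" for k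
      using cost m(2)[OF that] by simp
    show "\<exists>ystar \<in> admissible_paths L T.
           rate_functional S B (feedback e \<alpha> lam) L T ystar
             = (INF y\<in>admissible_paths L T. rate_functional S B (feedback e \<alpha> lam) L T y) \<and>
           (\<forall>t\<in>{0..<T}. norm (ystar t) < L) \<and> norm (ystar T) = L \<and>
           (\<forall>t\<in>{0..T}. \<forall>k\<ge>2. inner (ystar t) (e k) = 0)"
    proof (intro bexI[of _ "sinh_path L T"] conjI ballI allI impI)
      show "sinh_path L T \<in> admissible_paths L T"
        using assms(12) T by (rule sinh_path_admissible)
      then show "rate_functional S B u L T (sinh_path L T) =
          (INF y\<in>admissible_paths L T. rate_functional S B u L T y)"
        unfolding rate_functional_sinh_path[OF assms(12) T]
        by (intro antisym INF_greatest rate_functional_lower_bound gap assms(12) T)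
          (auto intro: INF_lower2 simp: rate_functional_sinh_path[OF assms(12) T])
      show "norm (sinh_path L T T) = L"
        using assms(12) T by (rule norm_sinh_path_final)
      show "norm (sinh_path L T t) < L" if "t \<in> {0..<T}" for t
        using that assms(12) T by (intro norm_sinh_path_less) auto
      show "inner (sinh_path L T t) (e k) = 0" if "2 \<le> k" for t k
        using that by (simp add: sinh_path_coordinate)
    qed
  qed simp
qed

end
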